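(* Let $0<S_B<1$ and $p_B\in[p_c^{(i)}(S_B),p_c^{(d)}(S_B)]$. Let $S_T\in[\bar S_d,S_B)$, $p_T=p_c^{(d)}(S_T)$ and suppose $F^{(d)}(S_T)<F(S_B,p_B)$. Then there exists $\tau_d^*(S_T)>0$ such that for all $0<\tau<\tau_d^*(S_T)$ there is an orbit $(S_{(d)},p_{(d)})$ of $$(\mathrm{TW})\qquad S'=\frac{1}{c\tau}\mathcal F(S,p),\qquad p'=\mathcal G(S,p)$$ connecting $E_B=(S_B,p_B)$ (as $\xi\to-\infty$) to $E_T=(S_T,p_T)$ (as $\xi\to\infty$). Moreover, for a fixed value $S_{(d)}=S\in[S_T,S_B)$ of the saturation along the orbit, the corresponding pressure satisfies $p_{(d)}\to p_c^{(d)}(S)$ as $\tau\to0$.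
   Context: Capillary pressures. $p_c^{(i)},p_c^{(d)}:(0,1]\to[0,\infty)$ are $C^1$ on $(0,1]$, vanish at $S=1$, have strictly negative derivative on $(0,1)$, and $p_c^{(i)}(S)<p_c^{(d)}(S)$ for $0<S<1$. Define $\mathcal H^{(i)}=\{(S,p):0<S\le1,\ p<p_c^{(i)}(S)\}$, $\mathcal H^{(d)}=\{(S,p):0<S\le1,\ p>p_c^{(d)}(S)\}$, $\mathcal H=\{(S,p):0<S\le1,\ p_c^{(i)}(S)\le p\le p_c^{(d)}(S)\}$, $\mathcal W=\mathcal H^{(i)}\cup\mathcal H\cup\mathcal H^{(d)}$, and $\mathcal F(S,p)=p_c^{(d)}(S)-p$ on $\mathcal H^{(d)}$, $\mathcal F=0$ on $\mathcal H$, $\mathcal F(S,p)=p_c^{(i)}(S)-p$ on $\mathcal H^{(i)}$. Hysteretic relative permeabilities. For $j\in\{i,d\}$, $k_{rw}^{(j)},k_{rn}^{(j)}\in C^2([0,1])$ are strictly convex, $k_{rw}^{(j)}(0)=0$, ${k_{rw}^{(j)}}'>0$ on $(0,1]$, $k_{rn}^{(j)}(1)=0$, ${k_{rn}^{(j)}}'<0$ on $[0,1)$, and $k_{rw}^{(i)}<k_{rw}^{(d)}$, $k_{rn}^{(d)}<k_{rn}^{(i)}$ on $(0,1)$. For $\alpha\in\{w,n\}$, $k_{r\alpha}(S,p)$ equals $k_{r\alpha}^{(d)}(S)$ on $\mathcal H^{(d)}$, $\bar k_{r\alpha}(S,p)$ on $\mathcal H$, $k_{r\alpha}^{(i)}(S)$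 on $\mathcal H^{(i)}$, where $\bar k_{r\alpha}:\mathcal H\to[0,\infty)$ is $C^2$, such that $k_{r\alpha}\in C(\mathcal W)$, and $\partial_p\bar k_{rw}>0$, $\partial_p\bar k_{rn}<0$ in $\mathcal H$. With constants $M>0$ and $N_g$ put $f=k_{rw}/(k_{rw}+Mk_{rn})$, $h=k_{rn}f$, $F=f+N_gh$ as functions of $(S,p)$; write $F^{(j)}(S)$, $h^{(j)}(S)$ for the values on $\mathcal H^{(j)}$ and $\bar F$ for $F$ restricted to $\mathcal H$. $N_g$ is small enough that: $F\in C(\mathcal W)$, $\bar F\in C^2(\mathcal H)$, $\partial_pF>0$ in $\mathcal H$; $F^{(d)}>F^{(i)}$ on $(0,1)$; and for $j\in\{i,d\}$, $F^{(j)}\in C^2([0,1])$, ${F^{(j)}}'>0$ on $(0,1)$, $F^{(j)}(0)=0$, $F^{(j)}(1)=1$, and $F^{(j)}$ has a unique inflection point in $(0,1)$, being strictly convex (${F^{(j)}}''>0$) to its left and strictly concave (${F^{(j)}}''<0$) to its right. $U_B=(S_B,F(S_B,p_B))$. $\bar S_d\le S_B$ is the $S$-coordinate of the point at which the tangent line drawn from $U_B$ touches the graph of $F^{(d)}$ ($\bar S_d=S_B$ if ${F^{(d)}}''(S_B)\ge0$ and $p_B=p_c^{(d)}(S_B)$). In (TW): $c=\dfrac{F(S_T,p_T)-F(S_B,p_B)}{S_T-S_B}$, $\ \mathcal G(S,p)=\dfrac{F(S,p)-\ell(S)}{h(S,p)}$, $\ \ell(S)=F(S_B,p_B)+c(S-S_B)$.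 The orbit $(S_{(d)},p_{(d)})$ is the one leaving $E_B$ through the vertical half-line $\{S=S_B,\ p>p_B\}$ and passing through $\mathcal H^{(d)}$; the value of $p_{(d)}$ at $S=S_T$ is understood as the limit for $\xi\to\infty$. *)

theory Defs
  imports "HOL-Analysis.Analysis"
begin

subsection \<open>Regularity on sets that need not be open\<close>

text \<open>Derivatives are taken within the set, hence one-sided at end points of intervals.\<close>

definition deriv_within :: "real set \<Rightarrow> (real \<Rightarrow> real) \<Rightarrow> real \<Rightarrow> real" where
  "deriv_within A u x = vector_derivative u (at x within A)"

definition C1_on :: "real set \<Rightarrow> (real \<Rightarrow> real) \<Rightarrow> bool" where
  "C1_on A u \<longleftrightarrow> u differentiable_on A \<and> continuous_on A (deriv_within A u)"

definition C2_on :: "real set \<Rightarrow> (real \<Rightarrow> real) \<Rightarrow> bool" where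
  "C2_on A u \<longleftrightarrow> C1_on A u \<and> C1_on A (deriv_within A u)"

definition strictly_convex_on :: "real set \<Rightarrow> (real \<Rightarrow> real) \<Rightarrow> bool" where
  "strictly_convex_on A u \<longleftrightarrow>
     (\<forall>x\<in>A. \<forall>y\<in>A. x \<noteq> y \<longrightarrow>
       (\<forall>t\<in>{0<..<1}. u ((1 - t) * x + t * y) < (1 - t) * u x + t * u y))"

definition has_C1_gradient ::
    "(real \<times> real \<Rightarrow> real) \<Rightarrow> (real \<times> real \<Rightarrow> real \<times> real) \<Rightarrow> (real \<times> real) set \<Rightarrow> bool" where
  "has_C1_gradient u g A \<longleftrightarrow>
     (\<forall>x\<in>A. (u has_derivative (\<lambda>v. g x \<bullet> v)) (at x within A)) \<and> continuous_on A g"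

text \<open>\<open>u\<close> is \<open>C\<^sup>2\<close> on \<open>A\<close> with gradient \<open>g = (\<partial>\<^sub>S u, \<partial>\<^sub>p u)\<close>. Where the
  within-derivative of \<open>u\<close> is not unique (in the hysteresis region below, this can only
  happen at the cusp \<open>(1, 0)\<close>), \<open>g\<close> is still determined by its continuity, because
  that region lies in the closure of its interior.\<close>

definition has_C2_gradient ::
    "(real \<times> real \<Rightarrow> real) \<Rightarrow> (real \<times> real \<Rightarrow> real \<times> real) \<Rightarrow> (real \<times> real) set \<Rightarrow> bool" where
  "has_C2_gradient u g A \<longleftrightarrow> has_C1_gradient u g A \<and>
     (\<exists>g1 g2. has_C1_gradient (\<lambda>x. fst (g x)) g1 A \<and> has_C1_gradient (\<lambda>x. snd (g x)) g2 A)"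

subsection \<open>Two-phase flow with capillary and permeability hysteresis\<close>

datatype branch = Imb | Drn  \<comment> \<open>imbibition \<open>(i)\<close>, drainage \<open>(d)\<close>\<close>

record hyst_data =
  pc :: "branch \<Rightarrow> real \<Rightarrow> real"
  krw :: "branch \<Rightarrow> real \<Rightarrow> real"
  krn :: "branch \<Rightarrow> real \<Rightarrow> real"
  krw_bar :: "real \<times> real \<Rightarrow> real"
  krn_bar :: "real \<times> real \<Rightarrow> real"
  visc_ratio :: real     \<comment> \<open>\<open>M\<close>\<close>
  gravity_num :: real    \<comment> \<open>\<open>N\<^sub>g\<close>\<close>

definition reg_imb :: "hyst_data \<Rightarrow> (real \<times> real) set" where
  "reg_imb X = {(S, p). 0 < S \<and> S \<le> 1 \<and> p < pc X Imb S}"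

definition reg_drn :: "hyst_data \<Rightarrow> (real \<times> real) set" where
  "reg_drn X = {(S, p). 0 < S \<and> S \<le> 1 \<and> pc X Drn S < p}"

definition reg_hyst :: "hyst_data \<Rightarrow> (real \<times> real) set" where
  "reg_hyst X = {(S, p). 0 < S \<and> S \<le> 1 \<and> pc X Imb S \<le> p \<and> p \<le> pc X Drn S}"

definition reg_all :: "hyst_data \<Rightarrow> (real \<times> real) set" where
  "reg_all X = reg_imb X \<union> reg_hyst X \<union> reg_drn X"

text \<open>The functions on \<open>\<W>\<close> below have no meaning outside \<open>reg_all X\<close>.\<close>

definition relax_F :: "hyst_data \<Rightarrow> real \<times> real \<Rightarrow> real" where
  "relax_F X x =
     (if x \<in> reg_drn X then pc X Drn (fst x) - snd x
      else if x \<in> reg_hyst X then 0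
      else pc X Imb (fst x) - snd x)"

definition glue ::
    "hyst_data \<Rightarrow> (branch \<Rightarrow> real \<Rightarrow> real) \<Rightarrow> (real \<times> real \<Rightarrow> real) \<Rightarrow> real \<times> real \<Rightarrow> real" where
  "glue X k kb x =
     (if x \<in> reg_drn X then k Drn (fst x)
      else if x \<in> reg_hyst X then kb x
      else k Imb (fst x))"

definition kw :: "hyst_data \<Rightarrow> real \<times> real \<Rightarrow> real" where
  "kw X = glue X (krw X) (krw_bar X)"

definition kn :: "hyst_data \<Rightarrow> real \<times> real \<Rightarrow> real" where
  "kn X = glue X (krn X) (krn_bar X)"

definition frac_flow :: "hyst_data \<Rightarrow> real \<times> real \<Rightarrow> real" where
  "frac_flow X x = kw X x / (kw X x + visc_ratio X * kn X x)"

definition grav_h :: "hyst_data \<Rightarrow> real \<times> real \<Rightarrow> real" where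
  "grav_h X x = kn X x * frac_flow X x"

definition flux :: "hyst_data \<Rightarrow> real \<times> real \<Rightarrow> real" where
  "flux X x = frac_flow X x + gravity_num X * grav_h X x"

text \<open>\<open>F\<^sup>(\<^sup>j\<^sup>)\<close>, the \<open>p\<close>-independent value of \<open>flux X\<close> on \<open>reg_imb X\<close> or \<open>reg_drn X\<close>; the
  same formula is used at \<open>S = 0\<close>.\<close>

definition flux_br :: "hyst_data \<Rightarrow> branch \<Rightarrow> real \<Rightarrow> real" where
  "flux_br X j S =
     (let f = krw X j S / (krw X j S + visc_ratio X * krn X j S)
      in f + gravity_num X * (krn X j S * f))"

subsection \<open>Standing assumptions\<close>

definition capillary_ok :: "hyst_data \<Rightarrow> bool" where
  "capillary_ok X \<longleftrightarrow>
     (\<forall>j. C1_on {0<..1} (pc X j) \<and> (\<forall>S\<in>{0<..1}. 0 \<le> pc X j S) \<and> pc X j 1 = 0 \<and>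
        (\<forall>S\<in>{0<..<1}. deriv_within {0<..1} (pc X j) S < 0)) \<and>
     (\<forall>S\<in>{0<..<1}. pc X Imb S < pc X Drn S)"

definition permeability_ok :: "hyst_data \<Rightarrow> bool" where
  "permeability_ok X \<longleftrightarrow>
     (\<forall>j. C2_on {0..1} (krw X j) \<and> strictly_convex_on {0..1} (krw X j) \<and> krw X j 0 = 0 \<and>
        (\<forall>S\<in>{0<..1}. deriv_within {0..1} (krw X j) S > 0)) \<and>
     (\<forall>j. C2_on {0..1} (krn X j) \<and> strictly_convex_on {0..1} (krn X j) \<and> krn X j 1 = 0 \<and>
        (\<forall>S\<in>{0..<1}. deriv_within {0..1} (krn X j) S < 0)) \<and>
     (\<forall>S\<in>{0<..<1}. krw X Imb S < krw X Drn S \<and> krn X Drn S < krn X Imb S) \<and>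
     (\<forall>x\<in>reg_hyst X. 0 \<le> krw_bar X x \<and> 0 \<le> krn_bar X x) \<and>
     continuous_on (reg_all X) (kw X) \<and> continuous_on (reg_all X) (kn X) \<and>
     (\<exists>g. has_C2_gradient (krw_bar X) g (reg_hyst X) \<and> (\<forall>x\<in>reg_hyst X. snd (g x) > 0)) \<and>
     (\<exists>g. has_C2_gradient (krn_bar X) g (reg_hyst X) \<and> (\<forall>x\<in>reg_hyst X. snd (g x) < 0))"

definition flux_ok :: "hyst_data \<Rightarrow> bool" where
  "flux_ok X \<longleftrightarrow>
     continuous_on (reg_all X) (flux X) \<and>
     (\<exists>g. has_C2_gradient (flux X) g (reg_hyst X) \<and> (\<forall>x\<in>reg_hyst X. snd (g x) > 0)) \<and>
     (\<forall>S\<in>{0<..<1}. flux_br X Imb S < flux_br X Drn S) \<and>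
     (\<forall>j. C2_on {0..1} (flux_br X j) \<and>
        (\<forall>S\<in>{0<..<1}. deriv_within {0..1} (flux_br X j) S > 0) \<and>
        flux_br X j 0 = 0 \<and> flux_br X j 1 = 1 \<and>
        (\<exists>!a. a \<in> {0<..<1} \<and>
           (\<forall>S\<in>{0<..<a}. deriv_within {0..1} (deriv_within {0..1} (flux_br X j)) S > 0) \<and>
           (\<forall>S\<in>{a<..<1}. deriv_within {0..1} (deriv_within {0..1} (flux_br X j)) S < 0)))"

definition hysteretic_flow :: "hyst_data \<Rightarrow> bool" where
  "hysteretic_flow X \<longleftrightarrow>
     visc_ratio X > 0 \<and> capillary_ok X \<and> permeability_ok X \<and> flux_ok X"

subsection \<open>Tangent point, travelling-wave system and drainage orbit\<close>

text \<open>\<open>Sb\<close> is the abscissa of the point where the tangent line drawn from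
  \<open>U\<^sub>B = (S\<^sub>B, F(S\<^sub>B, p\<^sub>B))\<close> touches the graph of \<open>F\<^sup>(\<^sup>d\<^sup>)\<close>. The strict \<open>Sb < SB\<close> excludes
  the spurious tangent at \<open>U\<^sub>B\<close> itself when \<open>U\<^sub>B\<close> lies on the strictly concave part of the
  graph. At most one \<open>Sb\<close> qualifies.\<close>

definition drainage_tangent_point :: "hyst_data \<Rightarrow> real \<Rightarrow> real \<Rightarrow> real \<Rightarrow> bool" where
  "drainage_tangent_point X SB pB Sb \<longleftrightarrow>
     (if deriv_within {0..1} (deriv_within {0..1} (flux_br X Drn)) SB \<ge> 0 \<and> pB = pc X Drn SB
      then Sb = SB
      else 0 \<le> Sb \<and> Sb < SB \<and>
           flux X (SB, pB) =
             flux_br X Drn Sb + deriv_within {0..1} (flux_br X Drn) Sb * (SB - Sb))"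

definition wave_speed :: "hyst_data \<Rightarrow> real \<times> real \<Rightarrow> real \<times> real \<Rightarrow> real" where
  "wave_speed X EB ET = (flux X ET - flux X EB) / (fst ET - fst EB)"

definition chord :: "hyst_data \<Rightarrow> real \<times> real \<Rightarrow> real \<times> real \<Rightarrow> real \<Rightarrow> real" where
  "chord X EB ET S = flux X EB + wave_speed X EB ET * (S - fst EB)"

definition TW_G :: "hyst_data \<Rightarrow> real \<times> real \<Rightarrow> real \<times> real \<Rightarrow> real \<times> real \<Rightarrow> real" where
  "TW_G X EB ET x = (flux X x - chord X EB ET (fst x)) / grav_h X x"

text \<open>Orbits are required to stay in \<open>S < 1\<close>, since \<open>h\<close> vanishes at \<open>S = 1\<close> and \<open>\<G>\<close> is
  undefined there.\<close>

definition TW_orbit ::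
    "hyst_data \<Rightarrow> real \<Rightarrow> real \<times> real \<Rightarrow> real \<times> real \<Rightarrow> (real \<Rightarrow> real) \<Rightarrow> (real \<Rightarrow> real) \<Rightarrow> bool" where
  "TW_orbit X \<tau> EB ET S p \<longleftrightarrow>
     (\<forall>\<xi>. (S \<xi>, p \<xi>) \<in> reg_all X \<and> S \<xi> < 1 \<and>
        (S has_real_derivative 1 / (wave_speed X EB ET * \<tau>) * relax_F X (S \<xi>, p \<xi>)) (at \<xi>) \<and>
        (p has_real_derivative TW_G X EB ET (S \<xi>, p \<xi>)) (at \<xi>))"

definition connects ::
    "(real \<Rightarrow> real) \<Rightarrow> (real \<Rightarrow> real) \<Rightarrow> real \<times> real \<Rightarrow> real \<times> real \<Rightarrow> bool" where
  "connects S p EB ET \<longleftrightarrow>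
     ((\<lambda>\<xi>. (S \<xi>, p \<xi>)) \<longlongrightarrow> EB) at_bot \<and> ((\<lambda>\<xi>. (S \<xi>, p \<xi>)) \<longlongrightarrow> ET) at_top"

text \<open>The orbit leaves \<open>E\<^sub>B\<close> upwards through \<open>{S = S\<^sub>B, p > p\<^sub>B}\<close> and passes through
  \<open>\<H>\<^sup>(\<^sup>d\<^sup>)\<close>. If \<open>p\<^sub>B = p\<^sub>c\<^sup>(\<^sup>d\<^sup>)(S\<^sub>B)\<close> the half-line is entirely contained in \<open>\<H>\<^sup>(\<^sup>d\<^sup>)\<close>, where
  \<open>S' < 0\<close>, so no orbit runs along it; then only \<open>p > p\<^sub>B\<close> is meaningful.\<close>

definition leaves_through_drainage ::
    "hyst_data \<Rightarrow> real \<Rightarrow> real \<Rightarrow> (real \<Rightarrow> real) \<Rightarrow> (real \<Rightarrow> real) \<Rightarrow> bool" where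
  "leaves_through_drainage X SB pB S p \<longleftrightarrow>
     (\<exists>\<xi>0. \<forall>\<xi>\<le>\<xi>0. p \<xi> > pB \<and> (pB < pc X Drn SB \<longrightarrow> S \<xi> = SB)) \<and>
     (\<exists>\<xi>. (S \<xi>, p \<xi>) \<in> reg_drn X)"

text \<open>\<open>P s\<close> is the pressure on the orbit \<open>(S, p)\<close> at saturation \<open>s\<close>, for \<open>ST \<le> s < SB\<close>;
  at \<open>ST\<close> it is the limit for \<open>\<xi> \<rightarrow> \<infinity>\<close>.\<close>

definition orbit_pressure ::
    "(real \<Rightarrow> real) \<Rightarrow> (real \<Rightarrow> real) \<Rightarrow> real \<Rightarrow> real \<Rightarrow> (real \<Rightarrow> real) \<Rightarrow> bool" where
  "orbit_pressure S p ST SB P \<longleftrightarrow>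
     (\<forall>s\<in>{ST<..<SB}. (\<exists>\<xi>. S \<xi> = s) \<and> (\<forall>\<xi>. S \<xi> = s \<longrightarrow> p \<xi> = P s)) \<and>
     (p \<longlongrightarrow> P ST) at_top"

end

theory Submission
  imports Defs "HOL-Complex_Analysis.Great_Picard"
begin

text \<open>Write \<open>P = p\<^sub>c\<^sup>(\<^sup>d\<^sup>)\<close>, \<open>e = c \<tau>\<close> and \<open>u = p - P(S)\<close>. In the drainage region both \<open>F\<close> and \<open>h\<close> depend on
\<open>S\<close> alone, so there \<open>\<G>\<close> is a function \<open>g(S)\<close>, and along an orbit with \<open>u > 0\<close> the saturation
decreases and can serve as parameter: \<open>u du/dS = - e g - P' u\<close>.

\<^item> The tangent construction gives \<open>g > 0\<close> on \<open>(S\<^sub>T, S\<^sub>B)\<close>: the slope of the chord from \<open>U\<^sub>B\<close> to a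
  point of the graph of \<open>F\<^sup>(\<^sup>d\<^sup>)\<close> decreases strictly to the right of the tangent point
  (\<open>drainage_flux_above_chord\<close>).

\<^item> In terms of \<open>w = u\<^sup>2\<close> and \<open>x = S\<^sub>B - S\<close> the equation becomes \<open>w' = 2 e g + 2 P' sqrt w\<close>, \<open>w(0) = 0\<close>,
  which is no longer singular at \<open>w = 0\<close>; Peano's theorem gives a solution, whether or not \<open>g\<close>
  vanishes at \<open>S\<^sub>B\<close>. Comparison gives \<open>w \<ge> 0\<close>, and since \<open>g > 0\<close> it cannot touch zero before
  \<open>S\<^sub>T\<close>. For small \<open>e\<close> the strong damping \<open>P' < 0\<close> makes \<open>u = \<kappa> (S - S\<^sub>T)\<close> with \<open>\<kappa> = O(e)\<close> an upper
  barrier; this forces \<open>u = 0\<close> at \<open>S\<^sub>T\<close>, and gives \<open>u \<rightarrow> 0\<close> as \<open>\<tau> \<rightarrow> 0\<close>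
  (\<open>overdamped_profile\<close>).

\<^item> On the orbit sought \<open>p' = \<G> > 0\<close>, also on the vertical segment \<open>S = S\<^sub>B\<close> in the hysteresis region,
  where \<open>F\<close> increases with \<open>p\<close>. Hence the whole orbit is a graph \<open>S = \<Sigma>(p)\<close> over \<open>(p\<^sub>B, p\<^sub>T)\<close>, with
  \<open>\<Sigma> = S\<^sub>B\<close> below \<open>P(S\<^sub>B)\<close> and \<open>\<Sigma>\<close> the inverse of \<open>P + u\<close> above, and it remains to solve the scalar
  autonomous equation \<open>p' = \<G>(\<Sigma>(p), p)\<close>. Its right-hand side is at most linear in the distance to
  either end, so the travel time to each end is infinite (\<open>autonomous_connection\<close>). This treats
  \<open>p\<^sub>B < P(S\<^sub>B)\<close> and \<open>p\<^sub>B = P(S\<^sub>B)\<close> together.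

The analytic part of the argument is \<open>drainage_connection\<close>; it is applied to the two-phase flow data
with \<open>K\<close> a bound for \<open>g(S) / (S - S\<^sub>T)\<close> and \<open>- b\<^sub>0\<close> a bound for \<open>P'\<close> on \<open>[S\<^sub>T, S\<^sub>B]\<close>, which yields
\<open>\<tau>\<^sub>d = b\<^sub>0\<^sup>2 / (4 c K)\<close>.\<close>

section \<open>Peano's existence theorem for scalar equations\<close>

text \<open>Tonelli's scheme: delaying the unknown by \<open>h\<close> turns the initial value problem into successive
integrations. The \<open>k\<close>-th iterate is final on \<open>[a, a + k h]\<close>, so finitely many of them reach \<open>b\<close>.\<close>

primrec tonelli_step :: "(real \<Rightarrow> real \<Rightarrow> real) \<Rightarrow> real \<Rightarrow> real \<Rightarrow> real \<Rightarrow> nat \<Rightarrow> real \<Rightarrow> real" where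
  "tonelli_step f a y0 h 0 = (\<lambda>x. y0)"
| "tonelli_step f a y0 h (Suc k) =
     (\<lambda>x. y0 + integral {a..x} (\<lambda>s. f s (tonelli_step f a y0 h k (max a (s - h)))))"

lemma continuous_delayed_integrand:
  fixes f :: "real \<Rightarrow> real \<Rightarrow> real" and w :: "real \<Rightarrow> real"
  assumes "continuous_on ({a..b} \<times> UNIV) (\<lambda>(x, y). f x y)"
    and "continuous_on {a..b} w" and "0 \<le> h"
  shows "continuous_on {a..b} (\<lambda>s. f s (w (max a (s - h))))"
proof -
  have "continuous_on {a..b} (\<lambda>s. w (max a (s - h)))"
    by (rule continuous_on_compose2[OF assms(2)]) (use assms(3) in \<open>auto intro!: continuous_intros\<close>)
  hence "continuous_on {a..b} (\<lambda>s. (s, w (max a (s - h))))"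
    by (intro continuous_intros)
  from continuous_on_compose2[OF assms(1) this] show ?thesis by auto
qed

lemma continuous_tonelli_step:
  assumes "continuous_on ({a..b} \<times> UNIV) (\<lambda>(x, y). f x y)" and "0 \<le> h"
  shows "continuous_on {a..b} (tonelli_step f a y0 h k)"
proof (induction k)
  case (Suc k)
  have "(\<lambda>s. f s (tonelli_step f a y0 h k (max a (s - h)))) integrable_on {a..b}"
    by (rule integrable_continuous_real[OF continuous_delayed_integrand[OF assms(1) Suc assms(2)]])
  from indefinite_integral_continuous_1[OF this] show ?case
    by (auto intro!: continuous_intros)
qed simp

text \<open>The delayed argument of a point of \<open>[a, a + (k + 1) h]\<close> lies in \<open>[a, a + k h]\<close>, where the iterate
under the integral has already settled.\<close>

lemma tonelli_step_stationary:
  assumes "0 \<le> h" "a \<le> x" "x \<le> a + real k * h"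
  shows "tonelli_step f a y0 h (Suc k) x = tonelli_step f a y0 h k x"
  using assms(2,3)
proof (induction k arbitrary: x)
  case 0
  then show ?case by simp
next
  case (Suc k)
  have "f s (tonelli_step f a y0 h (Suc k) (max a (s - h))) =
        f s (tonelli_step f a y0 h k (max a (s - h)))" if "s \<in> {a..x}" for s
  proof -
    have "max a (s - h) \<le> a + real k * h"
      using that Suc.prems assms(1) by (auto simp: algebra_simps)
    then show ?thesis using Suc.IH by simp
  qed
  hence "integral {a..x} (\<lambda>s. f s (tonelli_step f a y0 h (Suc k) (max a (s - h)))) =
        integral {a..x} (\<lambda>s. f s (tonelli_step f a y0 h k (max a (s - h))))"
    by (rule integral_cong)
  then show ?case by simp
qed

lemma delayed_solution_exists:
  fixes f :: "real \<Rightarrow> real \<Rightarrow> real"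
  assumes "continuous_on ({a..b} \<times> UNIV) (\<lambda>(x, y). f x y)" and "0 < h"
  obtains w where "continuous_on {a..b} w"
    "\<And>x. x \<in> {a..b} \<Longrightarrow> w x = y0 + integral {a..x} (\<lambda>s. f s (w (max a (s - h))))"
proof -
  obtain n :: nat where n: "(b - a) / h \<le> real n"
    using real_arch_simple by blast
  hence *: "b \<le> a + real n * h"
    using assms(2) by (simp add: field_simps)
  show thesis
  proof (rule that[of "tonelli_step f a y0 h n"])
    show "continuous_on {a..b} (tonelli_step f a y0 h n)"
      by (rule continuous_tonelli_step[OF assms(1)]) (use assms(2) in simp)
    fix x assume x: "x \<in> {a..b}"
    have "tonelli_step f a y0 h n x = tonelli_step f a y0 h (Suc n) x"
      by (rule tonelli_step_stationary[symmetric]) (use x * assms(2) in auto)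
    then show "tonelli_step f a y0 h n x =
       y0 + integral {a..x} (\<lambda>s. f s (tonelli_step f a y0 h n (max a (s - h))))"
      by simp
  qed
qed

text \<open>The solutions with delay \<open>1 / (n + 1)\<close> share the Lipschitz constant \<open>C\<close>, so a subsequence of them
converges uniformly, and the integral equation passes to the limit by dominated convergence.\<close>

theorem peano_existence:
  fixes f :: "real \<Rightarrow> real \<Rightarrow> real"
  assumes f: "continuous_on ({a..b} \<times> UNIV) (\<lambda>(x, y). f x y)"
    and bound: "\<And>x y. x \<in> {a..b} \<Longrightarrow> \<bar>f x y\<bar> \<le> C"
  obtains w where "w a = y0"
    "\<And>x. x \<in> {a..b} \<Longrightarrow> (w has_real_derivative f x (w x)) (at x within {a..b})"
proof -
  have "\<forall>n::nat. \<exists>w. continuous_on {a..b} w \<and> (\<forall>x\<in>{a..b}.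
      w x = y0 + integral {a..x} (\<lambda>s. f s (w (max a (s - 1 / real (Suc n))))))"
  proof
    fix n :: nat
    obtain w where "continuous_on {a..b} w"
      "\<And>x. x \<in> {a..b} \<Longrightarrow>
         w x = y0 + integral {a..x} (\<lambda>s. f s (w (max a (s - 1 / real (Suc n)))))"
      by (rule delayed_solution_exists[OF f, where h = "1 / real (Suc n)" and ?y0.0 = y0]) auto
    then show "\<exists>w. continuous_on {a..b} w \<and> (\<forall>x\<in>{a..b}.
      w x = y0 + integral {a..x} (\<lambda>s. f s (w (max a (s - 1 / real (Suc n))))))" by blast
  qed
  then obtain W where cW: "\<And>n. continuous_on {a..b} (W n)" and
    W: "\<And>n x. x \<in> {a..b} \<Longrightarrow>
      W n x = y0 + integral {a..x} (\<lambda>s. f s (W n (max a (s - 1 / real (Suc n)))))"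
    by metis
  define H where "H n = (\<lambda>s. f s (W n (max a (s - 1 / real (Suc n)))))" for n
  have cH: "continuous_on {a..b} (H n)" for n
    unfolding H_def by (rule continuous_delayed_integrand[OF f cW]) simp
  have bH: "\<bar>H n s\<bar> \<le> C" if "s \<in> {a..b}" for n s
    using bound that by (simp add: H_def)
  have dW: "(W n has_real_derivative H n x) (at x within {a..b})" if "x \<in> {a..b}" for n x
  proof (rule has_field_derivative_transform_within[OF _ zero_less_one that])
    show "((\<lambda>x. y0 + integral {a..x} (H n)) has_real_derivative H n x) (at x within {a..b})"
      using integral_has_real_derivative[OF cH that, of n] by (auto intro!: derivative_eq_intros)
  qed (simp add: W H_def)
  have lip: "\<bar>W n x - W n y\<bar> \<le> C * \<bar>x - y\<bar>" if "x \<in> {a..b}" "y \<in> {a..b}" for n x y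
    using field_differentiable_bound[of "{a..b}" "W n" "H n" C x y] dW bH that by auto
  have bW: "norm (W n x) \<le> \<bar>y0\<bar> + C * (b - a)" if "x \<in> {a..b}" for n x
  proof -
    have C0: "0 \<le> C" using bound[OF that, of 0] by linarith
    have "W n a = y0" using W[of a n] that by auto
    moreover have "\<bar>W n x - W n a\<bar> \<le> C * \<bar>x - a\<bar>" using lip[of x a n] that by simp
    moreover have "C * \<bar>x - a\<bar> \<le> C * (b - a)" using that C0 by (intro mult_left_mono) auto
    ultimately show ?thesis by auto
  qed
  have equi: "\<exists>d>0. \<forall>n y. y \<in> {a..b} \<and> norm (x - y) < d \<longrightarrow> norm (W n x - W n y) < e"
    if x: "x \<in> {a..b}" and e: "0 < e" for x e
  proof -
    have C0: "0 \<le> C" using bound[OF x, of 0] by linarith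
    show ?thesis
    proof (intro exI[of _ "e / (C + 1)"] conjI allI impI)
      show "0 < e / (C + 1)" using e C0 by simp
      fix n y assume y: "y \<in> {a..b} \<and> norm (x - y) < e / (C + 1)"
      have "C * \<bar>x - y\<bar> \<le> C * (e / (C + 1))" using y C0 by (intro mult_left_mono) auto
      also have "\<dots> < e" using e C0 by (simp add: field_simps)
      finally show "norm (W n x - W n y) < e" using lip[of x y n] x y by auto
    qed
  qed
  obtain w r where cw: "continuous_on {a..b} w" and r: "strict_mono (r :: nat \<Rightarrow> nat)" and
    unif: "\<And>e. 0 < e \<Longrightarrow> \<exists>N. \<forall>n x. n \<ge> N \<and> x \<in> {a..b} \<longrightarrow> norm (W (r n) x - w x) < e"
    by (rule Arzela_Ascoli[of "{a..b}" W, OF compact_Icc bW equi]) blast+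
  have lim: "(\<lambda>n. W (r n) x) \<longlonglongrightarrow> w x" if "x \<in> {a..b}" for x
    using unif that by (force simp: LIMSEQ_iff)
  \<comment> \<open>the delayed argument differs from \<open>s\<close> by at most the delay; the common Lipschitz constant absorbs it\<close>
  have limH: "(\<lambda>n. H (r n) s) \<longlonglongrightarrow> f s (w s)" if s: "s \<in> {a..b}" for s
  proof -
    define t where "t = (\<lambda>n. max a (s - 1 / real (Suc (r n))))"
    have t_in: "t n \<in> {a..b}" for n using s by (auto simp: t_def intro: order_trans[of _ s])
    have "(\<lambda>n. 1 / real (Suc (r n))) \<longlonglongrightarrow> 0"
      using LIMSEQ_subseq_LIMSEQ[OF lim_1_over_n[THEN LIMSEQ_Suc] r] by (simp add: o_def)
    hence "(\<lambda>n. max a (s - 1 / real (Suc (r n)))) \<longlonglongrightarrow> max a (s - 0)"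
      by (intro tendsto_intros)
    hence t: "t \<longlonglongrightarrow> s" unfolding t_def using s by (simp add: max_absorb2)
    have "(\<lambda>n. W (r n) (t n) - W (r n) s) \<longlonglongrightarrow> 0"
    proof (rule Lim_null_comparison[where g = "\<lambda>n. C * \<bar>t n - s\<bar>"])
      show "\<forall>\<^sub>F n in sequentially. norm (W (r n) (t n) - W (r n) s) \<le> C * \<bar>t n - s\<bar>"
        using lip t_in s by simp
      have "(\<lambda>n. C * \<bar>t n - s\<bar>) \<longlonglongrightarrow> C * \<bar>s - s\<bar>" by (intro tendsto_intros t)
      then show "(\<lambda>n. C * \<bar>t n - s\<bar>) \<longlonglongrightarrow> 0" by simp
    qed
    from tendsto_add[OF this lim[OF s]] have "(\<lambda>n. W (r n) (t n)) \<longlonglongrightarrow> w s" by simp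
    hence "(\<lambda>n. (s, W (r n) (t n))) \<longlonglongrightarrow> (s, w s)" by (intro tendsto_intros)
    from continuous_on_tendsto_compose[OF f this] s show ?thesis by (simp add: H_def t_def)
  qed
  have w_int: "w x = y0 + integral {a..x} (\<lambda>s. f s (w s))" if x: "x \<in> {a..b}" for x
  proof -
    have "(\<lambda>n. integral {a..x} (H (r n))) \<longlonglongrightarrow> integral {a..x} (\<lambda>s. f s (w s))"
    proof (rule dominated_convergence(2)[where h = "\<lambda>_. C"])
      show "H (r n) integrable_on {a..x}" for n
        by (rule integrable_continuous_real, rule continuous_on_subset[OF cH]) (use x in auto)
      show "(\<lambda>_. C) integrable_on {a..x}" by (rule integrable_const_ivl)
    qed (use bH limH x in auto)
    hence "(\<lambda>n. W (r n) x) \<longlonglongrightarrow> y0 + integral {a..x} (\<lambda>s. f s (w s))"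
      using W[OF x] unfolding H_def by (simp add: tendsto_intros)
    with lim[OF x] show ?thesis using LIMSEQ_unique by blast
  qed
  show thesis
  proof (cases "a \<le> b")
    case False
    then show thesis using that[of "\<lambda>_. y0"] by auto
  next
    case True
    have cf: "continuous_on {a..b} (\<lambda>s. f s (w s))"
    proof -
      have "continuous_on {a..b} (\<lambda>s. (s, w s))" by (intro continuous_intros cw)
      from continuous_on_compose2[OF f this] show ?thesis by auto
    qed
    show thesis
    proof (rule that)
      show "w a = y0" using w_int[of a] True by simp
      fix x assume x: "x \<in> {a..b}"
      show "(w has_real_derivative f x (w x)) (at x within {a..b})"
      proof (rule has_field_derivative_transform_within[OF _ zero_less_one x])
        show "((\<lambda>x. y0 + integral {a..x} (\<lambda>s. f s (w s))) has_real_derivative f x (w x))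
            (at x within {a..b})"
          using integral_has_real_derivative[OF cf x] by (auto intro!: derivative_eq_intros)
      qed (simp add: w_int)
    qed
  qed
qed

section \<open>Comparison and gluing\<close>

lemma continuous_on_Icc_bounded:
  fixes f :: "real \<Rightarrow> real"
  assumes "continuous_on {a..b} f"
  obtains B where "0 < B" "\<And>x. x \<in> {a..b} \<Longrightarrow> \<bar>f x\<bar> \<le> B"
  using compact_imp_bounded[OF compact_continuous_image[OF assms compact_Icc]]
  by (auto simp: bounded_pos)

text \<open>Comparison principle for differences of sub- and supersolutions: such a difference needs to be
controlled only where it has the wrong sign. After its last zero before a positive value it could
not increase.\<close>

lemma nonpos_if_decreasing_where_positive:
  fixes d :: "real \<Rightarrow> real"
  assumes cont: "continuous_on {a..b} d" and init: "d a \<le> 0"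
    and decr: "\<And>x. \<lbrakk>a < x; x < b; 0 < d x\<rbrakk> \<Longrightarrow> \<exists>D\<le>0. (d has_real_derivative D) (at x)"
    and x: "x \<in> {a..b}"
  shows "d x \<le> 0"
proof (rule ccontr)
  assume "\<not> d x \<le> 0"
  hence pos: "0 < d x" by simp
  define Z where "Z = {z \<in> {a..x}. d z \<le> 0}"
  have "closed Z"
  proof -
    have "closed ({a..x} \<inter> d -` {..0})"
      by (rule continuous_closed_preimage[OF continuous_on_subset[OF cont]]) (use x in auto)
    moreover have "Z = {a..x} \<inter> d -` {..0}" by (auto simp: Z_def)
    ultimately show ?thesis by simp
  qed
  moreover have "bounded Z" unfolding Z_def by (rule bounded_subset[OF bounded_closed_interval[of a x]]) auto
  ultimately have "compact Z" by (simp add: compact_eq_bounded_closed)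
  moreover have "a \<in> Z" using x init by (simp add: Z_def)
  ultimately obtain z where z: "z \<in> Z" "\<And>y. y \<in> Z \<Longrightarrow> y \<le> z"
    using compact_attains_sup[of Z] by blast
  have "z < x" using z(1) pos by (cases "z = x") (auto simp: Z_def)
  have "d x \<le> d z"
  proof (rule DERIV_nonpos_imp_decreasing_open[where f = d])
    show "z \<le> x" using \<open>z < x\<close> by simp
    show "continuous_on {z..x} d"
      by (rule continuous_on_subset[OF cont]) (use z(1) x in \<open>auto simp: Z_def\<close>)
    fix t assume t: "z < t" "t < x"
    have "t \<notin> Z" using z(2) t by force
    hence "0 < d t" using t z(1) by (auto simp: Z_def)
    with decr[of t] have "\<exists>D\<le>0. (d has_real_derivative D) (at t)"
      using t z(1) x by (auto simp: Z_def)
    then show "\<exists>y. (d has_real_derivative y) (at t) \<and> y \<le> 0" by blast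
  qed
  with z(1) pos show False by (simp add: Z_def)
qed

text \<open>Used to glue two pieces of an orbit, where the derivative is known on both sides of the joint.\<close>

lemma has_real_derivative_if_derivative_continuous:
  fixes f :: "real \<Rightarrow> real"
  assumes "isCont f a" and "isCont f' a"
    and "\<forall>\<^sub>F x in at a. (f has_real_derivative f' x) (at x)"
  shows "(f has_real_derivative f' a) (at a)"
  unfolding has_field_derivative_iff
proof (rule lhopital[where f' = f' and g' = "\<lambda>_. 1"])
  show "((\<lambda>x. f x - f a) \<longlongrightarrow> 0) (at a)"
    using assms(1) by (auto simp: isCont_def intro: LIM_zero)
  show "((\<lambda>x. x - a) \<longlongrightarrow> 0) (at a)" by (intro LIM_zero tendsto_ident_at)
  show "\<forall>\<^sub>F x in at a. x - a \<noteq> 0" by (auto simp: eventually_at_filter)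
  show "\<forall>\<^sub>F x in at a. ((\<lambda>x. f x - f a) has_real_derivative f' x) (at x)"
    using assms(3) by eventually_elim (auto intro!: derivative_eq_intros)
  show "((\<lambda>x. f' x / 1) \<longlongrightarrow> f' a) (at a)" using assms(2) by (simp add: isCont_def)
qed (auto intro!: derivative_eq_intros always_eventually)

section \<open>Heteroclinic orbits of scalar autonomous equations\<close>

text \<open>\<open>T\<close> is the time needed to travel to \<open>p\<close> at speed \<open>V\<close>. Since \<open>V p \<le> C (b - p)\<close>, it grows at least
like the time \<open>- ln (b - p) / C\<close> of the linear equation.\<close>

lemma travel_time_unbounded:
  fixes T V :: "real \<Rightarrow> real"
  assumes T: "\<And>p. \<lbrakk>m < p; p < b\<rbrakk> \<Longrightarrow> (T has_real_derivative 1 / V p) (at p)"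
    and V: "\<And>p. \<lbrakk>m < p; p < b\<rbrakk> \<Longrightarrow> 0 < V p \<and> V p \<le> C * (b - p)"
    and "m < b"
  shows "\<exists>p. m < p \<and> p < b \<and> t < T p"
proof -
  define k where "k = (m + b) / 2"
  have k: "m < k" "k < b" using \<open>m < b\<close> by (auto simp: k_def)
  have "0 < C * (b - k)" using V[OF k] by linarith
  hence C: "0 < C" using k by (simp add: zero_less_mult_iff)
  define s where "s = max 1 (t - T k + 1)"
  \<comment> \<open>at \<open>p = b - r\<close> the linear equation has used the additional time \<open>s\<close> since \<open>k\<close>\<close>
  define r where "r = (b - k) * exp (- (C * s))"
  define p where "p = b - r"
  have s: "1 \<le> s" "t < T k + s" by (auto simp: s_def)
  have "0 < r" "r < b - k" using k C s by (auto simp: r_def)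
  hence p: "k < p" "p < b" by (auto simp: p_def)
  have "T k + ln (b - k) / C \<le> T p + ln (b - p) / C"
  proof (rule DERIV_nonneg_imp_nondecreasing[where f = "\<lambda>x. T x + ln (b - x) / C"])
    show "k \<le> p" using p by simp
    fix x assume x: "k \<le> x" "x \<le> p"
    have V': "0 < V x" "V x \<le> C * (b - x)" using V[of x] x p k by auto
    have "((\<lambda>x. ln (b - x)) has_real_derivative - (1 / (b - x))) (at x)"
      using x p by (auto intro!: derivative_eq_intros)
    from DERIV_add[OF T DERIV_cdivide[OF this, of C]]
    have "((\<lambda>x. T x + ln (b - x) / C) has_real_derivative 1 / V x - 1 / (C * (b - x))) (at x)"
      using x k p by (simp add: mult.commute)
    moreover have "1 / (C * (b - x)) \<le> 1 / V x" using V' by (intro divide_left_mono) auto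
    ultimately show "\<exists>y. ((\<lambda>x. T x + ln (b - x) / C) has_real_derivative y) (at x) \<and> 0 \<le> y"
      by (intro exI conjI) auto
  qed
  moreover have "ln (b - p) = ln (b - k) - C * s"
    using k by (simp add: p_def r_def ln_mult)
  ultimately have "T k + s \<le> T p" using C by (simp add: diff_divide_distrib)
  with s p k show ?thesis by (intro exI[of _ p]) auto
qed

text \<open>Separation of variables: the travel time \<open>T\<close>, a primitive of \<open>1 / V\<close>, maps \<open>(a, b)\<close> onto the
whole real line because \<open>V\<close> is at most linear at both ends, and the orbit is its inverse.\<close>

theorem autonomous_connection:
  fixes V :: "real \<Rightarrow> real"
  assumes "a < b" and cont: "continuous_on {a<..<b} V"
    and pos: "\<And>p. \<lbrakk>a < p; p < b\<rbrakk> \<Longrightarrow> 0 < V p"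
    and m: "a < m" and lo: "\<And>p. \<lbrakk>a < p; p < m\<rbrakk> \<Longrightarrow> V p \<le> A * (p - a)"
    and n: "n < b" and hi: "\<And>p. \<lbrakk>n < p; p < b\<rbrakk> \<Longrightarrow> V p \<le> B * (b - p)"
  obtains q where "\<And>t. a < q t \<and> q t < b"
    and "\<And>t. (q has_real_derivative V (q t)) (at t)"
    and "(q \<longlongrightarrow> a) at_bot" and "(q \<longlongrightarrow> b) at_top"
    and "\<And>p. \<lbrakk>a < p; p < b\<rbrakk> \<Longrightarrow> \<exists>t. q t = p"
proof -
  have contV: "isCont V p" if "a < p" "p < b" for p
    using cont that by (simp add: continuous_on_eq_continuous_at)
  have "\<exists>T. \<forall>x::real. ereal a < ereal x \<longrightarrow> ereal x < ereal b \<longrightarrow>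
      (T has_vector_derivative 1 / V x) (at x)"
  proof (rule einterval_antiderivative)
    fix x assume "ereal a < ereal x" "ereal x < ereal b"
    then show "isCont (\<lambda>x. 1 / V x) x"
      using contV[of x] pos[of x] by (intro continuous_intros) auto
  qed (use \<open>a < b\<close> in simp)
  then obtain T where T: "\<And>x. \<lbrakk>a < x; x < b\<rbrakk> \<Longrightarrow> (T has_real_derivative 1 / V x) (at x)"
    by (auto simp: has_real_derivative_iff_has_vector_derivative)
  have mono: "T x < T y" if "a < x" "x < y" "y < b" for x y
  proof (rule DERIV_pos_imp_increasing[OF \<open>x < y\<close>])
    fix z assume "x \<le> z" "z \<le> y"
    then show "\<exists>D. (T has_real_derivative D) (at z) \<and> 0 < D"
      using T[of z] pos[of z] that by (intro exI[of _ "1 / V z"]) auto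
  qed
  have above: "\<exists>p. a < p \<and> p < b \<and> t < T p" for t
  proof -
    have "\<exists>p. max a n < p \<and> p < b \<and> t < T p"
      by (rule travel_time_unbounded[where V = V and C = B]) (use T pos hi n \<open>a < b\<close> in auto)
    then show ?thesis by auto
  qed
  \<comment> \<open>reflection at the origin exchanges the two ends of the interval\<close>
  have below: "\<exists>p. a < p \<and> p < b \<and> T p < t" for t
  proof -
    have "\<exists>p. - min b m < p \<and> p < - a \<and> - t < - T (- p)"
    proof (rule travel_time_unbounded[where V = "\<lambda>p. V (- p)" and C = A])
      fix p assume p: "- min b m < p" "p < - a"
      have "((\<lambda>p. T (- p)) has_real_derivative (1 / V (- p)) * (- 1)) (at p)"
        by (rule DERIV_chain2[where f = T and g = uminus]) (use p in \<open>auto intro!: T derivative_eq_intros\<close>)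
      from DERIV_minus[OF this]
      show "((\<lambda>p. - T (- p)) has_real_derivative 1 / V (- p)) (at p)" by simp
      have "a < - p" "- p < b" "- p < m" using p by (simp_all add: minus_less_iff[of "min b m"])
      moreover have "- a - p = - p - a" by simp
      ultimately show "0 < V (- p) \<and> V (- p) \<le> A * (- a - p)"
        using pos[of "- p"] lo[of "- p"] by metis
    qed (use m \<open>a < b\<close> in auto)
    then obtain p where "- min b m < p" "p < - a" "- t < - T (- p)" by blast
    then show ?thesis by (intro exI[of _ "- p"]) auto
  qed
  have surj: "\<exists>p. a < p \<and> p < b \<and> T p = t" for t
  proof -
    obtain x where x: "a < x" "x < b" "T x < t" using below by blast
    obtain y where y: "a < y" "y < b" "t < T y" using above by blast
    have "x < y" using mono[of y x] x y by (cases x y rule: linorder_cases) auto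
    moreover have "\<forall>z. x \<le> z \<and> z \<le> y \<longrightarrow> isCont T z"
      using x y by (auto intro!: DERIV_isCont[OF T])
    ultimately obtain z where "x \<le> z" "z \<le> y" "T z = t"
      using IVT[of T x t y] x y by auto
    then show ?thesis using x y by (intro exI[of _ z]) auto
  qed
  then obtain q where q: "\<And>t. a < q t \<and> q t < b \<and> T (q t) = t" by metis
  have qT: "q (T p) = p" if "a < p" "p < b" for p
    using mono[of p "q (T p)"] mono[of "q (T p)" p] q[of "T p"] that
    by (cases p "q (T p)" rule: linorder_cases) auto
  have cq: "isCont q t" for t
  proof -
    have "isCont q (T (q t))"
    proof (rule isCont_inverse_function2[where f = T and x = "q t" and a = "(a + q t) / 2" and b = "(q t + b) / 2"])
      show "(a + q t) / 2 < q t" "q t < (q t + b) / 2" using q[of t] by auto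
      show "q (T z) = z" "isCont T z" if "(a + q t) / 2 \<le> z" "z \<le> (q t + b) / 2" for z
      proof -
        have z: "a < z" "z < b" using that q[of t] by auto
        show "q (T z) = z" by (rule qT[OF z])
        show "isCont T z" by (rule DERIV_isCont[OF T[OF z]])
      qed
    qed
    then show ?thesis using q by simp
  qed
  have q_gt: "p < q t" if "a < p" "p < b" "T p < t" for p t
    using mono[of "q t" p] q[of t] that by (cases p "q t" rule: linorder_cases) auto
  have q_lt: "q t < p" if "a < p" "p < b" "t < T p" for p t
    using mono[of p "q t"] q[of t] that by (cases p "q t" rule: linorder_cases) auto
  show thesis
  proof (rule that)
    show "a < q t \<and> q t < b" for t using q by simp
    show "(q has_real_derivative V (q t)) (at t)" for t
    proof -
      have "(q has_real_derivative inverse (1 / V (q t))) (at t)"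
        by (rule DERIV_inverse_function[where f = T and a = "t - 1" and b = "t + 1"])
           (use q[of t] q T pos[of "q t"] cq in auto)
      then show ?thesis by simp
    qed
    show "(q \<longlongrightarrow> a) at_bot"
    proof (rule order_tendstoI)
      fix y assume "y < a"
      then show "\<forall>\<^sub>F t in at_bot. y < q t" using q by (intro always_eventually) (auto intro: less_trans)
    next
      fix y assume y: "a < y"
      obtain p where p: "a < p" "p < b" "p < y" using dense[of a "min b y"] y \<open>a < b\<close> by auto
      show "\<forall>\<^sub>F t in at_bot. q t < y"
        using eventually_gt_at_bot[of "T p"] by eventually_elim (use q_lt p in \<open>auto intro: less_trans\<close>)
    qed
    show "(q \<longlongrightarrow> b) at_top"
    proof (rule order_tendstoI)
      fix y assume "b < y"
      then show "\<forall>\<^sub>F t in at_top. q t < y" using q by (intro always_eventually) (auto intro: less_trans)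
    next
      fix y assume y: "y < b"
      obtain p where p: "a < p" "p < b" "y < p" using dense[of "max a y" b] y \<open>a < b\<close> by auto
      show "\<forall>\<^sub>F t in at_top. y < q t"
        using eventually_gt_at_top[of "T p"] by eventually_elim (use q_gt p in \<open>auto intro: less_trans\<close>)
    qed
    show "\<exists>t. q t = p" if "a < p" "p < b" for p using qT[OF that] by blast
  qed
qed

section \<open>Strongly damped passage through the drainage region\<close>

text \<open>\<open>P\<close> is the capillary pressure curve, \<open>g\<close> the pressure velocity in the drainage region, \<open>e = c \<tau>\<close>,
and \<open>u\<close> the excess of the pressure over \<open>P\<close> along the orbit, as a function of the saturation.
As a function of \<open>x = S\<^sub>B - S\<close>, the square \<open>w = u\<^sup>2\<close> solves \<open>w' = 2 e g + 2 P' sqrt w\<close>, whose right-hand side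
is continuous also at \<open>w = 0\<close>. The upper bound \<open>u \<le> k (S - S\<^sub>T)\<close> rests on \<open>v = k\<^sup>2 (S - S\<^sub>T)\<^sup>2\<close> being a
supersolution: with \<open>y = S - S\<^sub>T\<close> this requires \<open>b\<^sub>0 k y \<ge> e K y + k\<^sup>2 y\<close>. For \<open>k = 2 e K / b\<^sub>0\<close> the left-hand side is
\<open>2 e K y\<close>, and the smallness of \<open>e\<close> is precisely \<open>k\<^sup>2 \<le> e K\<close>.\<close>

lemma overdamped_profile:
  fixes g P' :: "real \<Rightarrow> real"
  assumes "ST < SB" and e: "0 < e" and K: "0 < K" and b0: "0 < b0" and small: "4 * e * K \<le> b0\<^sup>2"
    and cP': "continuous_on {ST..SB} P'" and P': "\<And>S. S \<in> {ST..SB} \<Longrightarrow> P' S \<le> - b0"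
    and cg: "continuous_on {ST..SB} g" and g_pos: "\<And>S. S \<in> {ST<..<SB} \<Longrightarrow> 0 < g S"
    and g_le: "\<And>S. S \<in> {ST..SB} \<Longrightarrow> g S \<le> K * (S - ST)"
  obtains u where "continuous_on {ST..SB} u" and "u SB = 0"
    and "\<And>S. S \<in> {ST<..<SB} \<Longrightarrow> 0 < u S"
    and "\<And>S. S \<in> {ST<..<SB} \<Longrightarrow> (u has_real_derivative - (e * g S / u S) - P' S) (at S)"
    and "\<And>S. S \<in> {ST..SB} \<Longrightarrow> 0 \<le> u S \<and> u S \<le> 2 * e * K / b0 * (S - ST)"
proof -
  define L where "L = SB - ST"
  define k where "k = 2 * e * K / b0"
  define Y where "Y = (k * L)\<^sup>2"
  \<comment> \<open>the square root, truncated to make the right-hand side bounded and total;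
    the solution never leaves the range \<open>[0, Y]\<close> where the truncation is inactive\<close>
  define \<phi> where "\<phi> y = sqrt (min (max y 0) Y)" for y
  define f where "f x y = 2 * e * g (SB - x) + 2 * P' (SB - x) * \<phi> y" for x y
  have L: "0 < L" using \<open>ST < SB\<close> by (simp add: L_def)
  have k: "0 < k" using e K b0 by (simp add: k_def)
  have kb: "k * b0 = 2 * e * K" using b0 by (simp add: k_def)
  have k2: "k\<^sup>2 \<le> e * K"
  proof -
    have "k\<^sup>2 * b0\<^sup>2 = (k * b0)\<^sup>2" by (simp add: power_mult_distrib)
    also have "\<dots> = (e * K) * (4 * e * K)" unfolding kb by (simp add: power2_eq_square)
    also have "\<dots> \<le> (e * K) * b0\<^sup>2" using small e K by (intro mult_left_mono) auto
    finally show ?thesis using b0 by simp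
  qed
  have Sx: "SB - x \<in> {ST..SB}" if "x \<in> {0..L}" for x using that by (auto simp: L_def)
  have cg': "continuous_on {0..L} (\<lambda>x. g (SB - x))" and cP'': "continuous_on {0..L} (\<lambda>x. P' (SB - x))"
    by (auto intro!: continuous_on_compose2[OF cg] continuous_on_compose2[OF cP'] continuous_intros
        simp: L_def)
  obtain A where A: "\<And>x. x \<in> {0..L} \<Longrightarrow> \<bar>g (SB - x)\<bar> \<le> A"
    using continuous_on_Icc_bounded[OF cg'] by blast
  obtain B where B: "\<And>x. x \<in> {0..L} \<Longrightarrow> \<bar>P' (SB - x)\<bar> \<le> B"
    using continuous_on_Icc_bounded[OF cP''] by blast
  have Y: "0 \<le> Y" by (simp add: Y_def)
  have \<phi>: "0 \<le> \<phi> y \<and> \<phi> y \<le> sqrt Y" for y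
    using Y by (auto simp: \<phi>_def)
  obtain w where w0: "w 0 = 0" and
    w': "\<And>x. x \<in> {0..L} \<Longrightarrow> (w has_real_derivative f x (w x)) (at x within {0..L})"
  proof (rule peano_existence[where f = f and a = 0 and b = L and ?y0.0 = 0
        and C = "2 * e * A + 2 * B * sqrt Y"])
    have "continuous_on ({0..L} \<times> (UNIV :: real set)) (\<lambda>z. g (SB - fst z))"
      "continuous_on ({0..L} \<times> (UNIV :: real set)) (\<lambda>z. P' (SB - fst z))"
      by (rule continuous_on_compose2[OF cg'] continuous_on_compose2[OF cP''];
          auto intro!: continuous_intros)+
    then show "continuous_on ({0..L} \<times> UNIV) (\<lambda>(x, y). f x y)"
      unfolding f_def \<phi>_def case_prod_beta by (intro continuous_intros)
    fix x y :: real assume x: "x \<in> {0..L}"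
    have "\<bar>f x y\<bar> \<le> \<bar>2 * e * g (SB - x)\<bar> + \<bar>2 * P' (SB - x) * \<phi> y\<bar>"
      unfolding f_def by (rule abs_triangle_ineq)
    also have "\<dots> = 2 * e * \<bar>g (SB - x)\<bar> + 2 * (\<bar>P' (SB - x)\<bar> * \<phi> y)"
      using e \<phi>[of y] by (simp add: abs_mult)
    also have "\<dots> \<le> 2 * e * A + 2 * (B * sqrt Y)"
    proof (intro add_mono mult_left_mono mult_mono)
      show "0 \<le> B" using B[OF x] by linarith
    qed (use A[OF x] B[OF x] \<phi>[of y] e in auto)
    finally show "\<bar>f x y\<bar> \<le> 2 * e * A + 2 * B * sqrt Y" by simp
  qed blast
  have cw: "continuous_on {0..L} w"
    by (rule DERIV_continuous_on[OF w'])
  have dw: "(w has_real_derivative f x (w x)) (at x)" if "0 < x" "x < L" for x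
    using w'[of x] that at_within_Icc_at[of 0 x L] by simp
  have nonneg: "0 \<le> w x" if "x \<in> {0..L}" for x
  proof -
    have "- w x \<le> 0"
    proof (rule nonpos_if_decreasing_where_positive[where d = "\<lambda>x. - w x", OF _ _ _ that])
      fix y assume y: "0 < y" "y < L" "0 < - w y"
      have "0 < f y (w y)"
        using g_pos[of "SB - y"] y e Y by (auto simp: f_def \<phi>_def L_def)
      with DERIV_minus[OF dw[OF y(1,2)]]
      show "\<exists>D\<le>0. ((\<lambda>x. - w x) has_real_derivative D) (at y)"
        by (intro exI[of _ "- f y (w y)"]) auto
    qed (use cw w0 in \<open>auto intro!: continuous_intros\<close>)
    then show ?thesis by simp
  qed
  have upper: "w x \<le> (k * (L - x))\<^sup>2" if "x \<in> {0..L}" for x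
  proof -
    have "w x - (k * (L - x))\<^sup>2 \<le> 0"
    proof (rule nonpos_if_decreasing_where_positive[where d = "\<lambda>x. w x - (k * (L - x))\<^sup>2", OF _ _ _ that])
      fix x assume x: "0 < x" "x < L" "0 < w x - (k * (L - x))\<^sup>2"
      define y where "y = L - x"
      have y: "0 < y" "y \<le> L" using x by (auto simp: y_def)
      have "(k * y)\<^sup>2 \<le> Y" unfolding Y_def using k y by (intro power_mono mult_left_mono) auto
      hence "(k * y)\<^sup>2 \<le> min (max (w x) 0) Y" using x by (auto simp: y_def)
      hence "sqrt ((k * y)\<^sup>2) \<le> \<phi> (w x)" unfolding \<phi>_def by (rule real_sqrt_le_mono)
      hence ky: "k * y \<le> \<phi> (w x)" using k y by simp
      have gy: "g (SB - x) \<le> K * y"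
        using g_le[of "SB - x"] x by (simp add: y_def L_def algebra_simps)
      have "b0 * (k * y) \<le> (- P' (SB - x)) * \<phi> (w x)"
        by (rule mult_mono) (use P'[of "SB - x"] x b0 k y ky in \<open>auto simp: L_def\<close>)
      moreover have "b0 * (k * y) = 2 * (e * K) * y"
      proof -
        have "b0 * (k * y) = (k * b0) * y" by (simp only: mult_ac)
        then show ?thesis unfolding kb by simp
      qed
      moreover have "e * g (SB - x) \<le> e * (K * y)" using gy e by simp
      moreover have "k\<^sup>2 * y \<le> (e * K) * y" using k2 y by (intro mult_right_mono) auto
      ultimately have "f x (w x) + 2 * k\<^sup>2 * y \<le> 0" unfolding f_def by (simp add: mult.assoc)
      moreover have "((\<lambda>x. w x - (k * (L - x))\<^sup>2) has_real_derivative f x (w x) + 2 * k\<^sup>2 * y) (at x)"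
        using dw[OF x(1,2)]
        by (auto intro!: derivative_eq_intros simp: y_def power2_eq_square algebra_simps)
      ultimately show "\<exists>D\<le>0. ((\<lambda>x. w x - (k * (L - x))\<^sup>2) has_real_derivative D) (at x)" by blast
    qed (use cw w0 in \<open>auto intro!: continuous_intros\<close>)
    then show ?thesis by simp
  qed
  have wY: "\<phi> (w x) = sqrt (w x)" if "x \<in> {0..L}" for x
  proof -
    have "(k * (L - x))\<^sup>2 \<le> Y" unfolding Y_def using that k by (intro power_mono mult_left_mono) auto
    with upper[OF that] nonneg[OF that] show ?thesis by (simp add: \<phi>_def)
  qed
  \<comment> \<open>a zero of \<open>w\<close> inside the interval would be a minimum, but there \<open>w' = 2 e g > 0\<close>\<close>
  have pos: "0 < w x" if x: "0 < x" "x < L" for x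
  proof (rule ccontr)
    assume "\<not> 0 < w x"
    hence w0: "w x = 0" using nonneg[of x] x by auto
    have "f x (w x) = 0"
    proof (rule DERIV_local_min[OF dw[OF x]])
      show "0 < min x (L - x)" using x by simp
      show "\<forall>y. \<bar>x - y\<bar> < min x (L - x) \<longrightarrow> w x \<le> w y"
      proof (intro allI impI)
        fix y assume "\<bar>x - y\<bar> < min x (L - x)"
        hence "y \<in> {0..L}" by auto
        from nonneg[OF this] w0 show "w x \<le> w y" by simp
      qed
    qed
    moreover have "0 < f x (w x)"
      using g_pos[of "SB - x"] x e Y w0 by (auto simp: f_def \<phi>_def L_def)
    ultimately show False by simp
  qed
  show thesis
  proof (rule that[of "\<lambda>S. sqrt (w (SB - S))"])
    show "continuous_on {ST..SB} (\<lambda>S. sqrt (w (SB - S)))"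
      by (intro continuous_intros continuous_on_compose2[OF cw]) (auto simp: L_def)
    show "sqrt (w (SB - SB)) = 0" by (simp add: w0)
    fix S
    {
      assume "S \<in> {ST<..<SB}"
      hence x: "0 < SB - S" "SB - S < L" by (auto simp: L_def)
      show p: "0 < sqrt (w (SB - S))" using pos[OF x] by simp
      have "((\<lambda>S. w (SB - S)) has_real_derivative f (SB - S) (w (SB - S)) * (- 1)) (at S)"
        by (rule DERIV_chain2[where f = w and g = "\<lambda>S. SB - S" and x = S, OF dw[OF x]])
           (auto intro!: derivative_eq_intros)
      from DERIV_chain2[where f = sqrt and g = "\<lambda>S. w (SB - S)" and x = S,
          OF DERIV_real_sqrt[OF pos[OF x]] this]
      have "((\<lambda>S. sqrt (w (SB - S))) has_real_derivative
          inverse (sqrt (w (SB - S))) / 2 * (f (SB - S) (w (SB - S)) * (- 1))) (at S)" by simp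
      moreover have "inverse (sqrt (w (SB - S))) / 2 * (f (SB - S) (w (SB - S)) * (- 1)) =
          - (e * g S / sqrt (w (SB - S))) - P' S"
        using p x wY[of "SB - S"] by (simp add: f_def field_simps)
      ultimately show "((\<lambda>S. sqrt (w (SB - S))) has_real_derivative
          - (e * g S / sqrt (w (SB - S))) - P' S) (at S)" by simp
    }
    assume "S \<in> {ST..SB}"
    hence x: "SB - S \<in> {0..L}" by (auto simp: L_def)
    have "sqrt (w (SB - S)) \<le> sqrt ((k * (L - (SB - S)))\<^sup>2)"
      using upper[OF x] by (rule real_sqrt_le_mono)
    also have "\<dots> = k * (S - ST)" using k x by (simp add: L_def)
    finally show "0 \<le> sqrt (w (SB - S)) \<and> sqrt (w (SB - S)) \<le> 2 * e * K / b0 * (S - ST)"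
      using nonneg[OF x] by (simp add: k_def)
  qed
qed

text \<open>Along the profile the pressure \<open>P + u\<close> has derivative \<open>- e g / u < 0\<close>, so it can be inverted. Extending
the inverse by \<open>S\<^sub>B\<close> to lower pressures appends the vertical part of the orbit, and extending it by
\<open>S\<^sub>T\<close> to higher ones makes it continuous on the whole line, so that limits pass through it.\<close>

lemma saturation_as_function_of_pressure:
  fixes P P' g u :: "real \<Rightarrow> real"
  assumes "ST < SB" and e: "0 < e"
    and dP: "\<And>S. S \<in> {ST..SB} \<Longrightarrow> (P has_real_derivative P' S) (at S)"
    and g_pos: "\<And>S. S \<in> {ST<..<SB} \<Longrightarrow> 0 < g S"
    and cu: "continuous_on {ST..SB} u" and "u ST = 0" and "u SB = 0"
    and u_pos: "\<And>S. S \<in> {ST<..<SB} \<Longrightarrow> 0 < u S"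
    and du: "\<And>S. S \<in> {ST<..<SB} \<Longrightarrow> (u has_real_derivative - (e * g S / u S) - P' S) (at S)"
  obtains \<Sigma> where "continuous_on UNIV \<Sigma>"
    and "\<And>p. p \<le> P SB \<Longrightarrow> \<Sigma> p = SB" and "\<Sigma> (P ST) = ST" and "P SB < P ST"
    and "\<And>p. p \<in> {P SB<..<P ST} \<Longrightarrow> \<Sigma> p \<in> {ST<..<SB} \<and> P (\<Sigma> p) + u (\<Sigma> p) = p"
    and "\<And>S. S \<in> {ST<..<SB} \<Longrightarrow> P S + u S \<in> {P SB<..<P ST} \<and> \<Sigma> (P S + u S) = S"
    and "\<And>p. p \<in> {P SB<..<P ST} \<Longrightarrow>
           (\<Sigma> has_real_derivative - (u (\<Sigma> p) / (e * g (\<Sigma> p)))) (at p)"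
proof -
  define \<pi> where "\<pi> S = P S + u S" for S
  have ends: "\<pi> ST = P ST" "\<pi> SB = P SB" using \<open>u ST = 0\<close> \<open>u SB = 0\<close> by (auto simp: \<pi>_def)
  have cP: "continuous_on {ST..SB} P"
    by (rule DERIV_continuous_on[OF has_field_derivative_at_within[OF dP]])
  have c\<pi>: "continuous_on {ST..SB} \<pi>"
    unfolding \<pi>_def by (intro continuous_intros cP cu)
  have d\<pi>: "(\<pi> has_real_derivative - (e * g S / u S)) (at S)" if "S \<in> {ST<..<SB}" for S
    using DERIV_add[OF dP du[OF that]] that unfolding \<pi>_def by simp
  have decr: "\<pi> y < \<pi> x" if "ST \<le> x" "x < y" "y \<le> SB" for x y
  proof (rule DERIV_neg_imp_decreasing_open[OF \<open>x < y\<close>, where f = \<pi>])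
    fix z assume "x < z" "z < y"
    hence z: "z \<in> {ST<..<SB}" using that by auto
    show "\<exists>D. (\<pi> has_real_derivative D) (at z) \<and> D < 0"
      using d\<pi>[OF z] u_pos[OF z] g_pos[OF z] e by (intro exI[of _ "- (e * g z / u z)"]) simp
  qed (rule continuous_on_subset[OF c\<pi>], use that in auto)
  have inj: "inj_on \<pi> {ST..SB}"
    by (rule inj_onI) (metis atLeastAtMost_iff decr less_irrefl linorder_neq_iff)
  have img: "\<pi> ` {ST..SB} = {P SB..P ST}"
  proof
    show "\<pi> ` {ST..SB} \<subseteq> {P SB..P ST}"
    proof clarify
      fix S assume "S \<in> {ST..SB}"
      then show "\<pi> S \<in> {P SB..P ST}"
        using decr[of ST S] decr[of S SB] by (cases "S = ST"; cases "S = SB") (auto simp: ends[symmetric])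
    qed
    show "{P SB..P ST} \<subseteq> \<pi> ` {ST..SB}"
    proof
      fix p assume "p \<in> {P SB..P ST}"
      then obtain x where "ST \<le> x" "x \<le> SB" "\<pi> x = p"
        using IVT2'[of \<pi> SB p ST] c\<pi> ends \<open>ST < SB\<close> by auto
      then show "p \<in> \<pi> ` {ST..SB}" by auto
    qed
  qed
  define \<sigma> where "\<sigma> = the_inv_into {ST..SB} \<pi>"
  have \<sigma>\<pi>: "\<sigma> (\<pi> S) = S" if "S \<in> {ST..SB}" for S
    unfolding \<sigma>_def by (rule the_inv_into_f_f[OF inj that])
  have \<pi>\<sigma>: "\<pi> (\<sigma> p) = p" if "p \<in> {P SB..P ST}" for p
    unfolding \<sigma>_def by (rule f_the_inv_into_f[OF inj]) (use that img in simp)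
  have \<sigma>_in: "\<sigma> p \<in> {ST..SB}" if "p \<in> {P SB..P ST}" for p
    unfolding \<sigma>_def by (rule the_inv_into_into[OF inj _ subset_refl]) (use that img in simp)
  have c\<sigma>: "continuous_on {P SB..P ST} \<sigma>"
    using continuous_on_inv_into[OF c\<pi> compact_Icc inj] img by (simp add: \<sigma>_def)
  have PP: "P SB < P ST" using decr[of ST SB] \<open>ST < SB\<close> ends by simp
  define \<Sigma> where "\<Sigma> p = \<sigma> (max (P SB) (min (P ST) p))" for p
  have \<Sigma>_eq: "\<Sigma> p = \<sigma> p" if "p \<in> {P SB..P ST}" for p
    using that by (simp add: \<Sigma>_def)
  have c\<Sigma>: "continuous_on UNIV \<Sigma>"
    unfolding \<Sigma>_def
    by (rule continuous_on_compose2[OF c\<sigma>]) (use PP in \<open>auto intro!: continuous_intros\<close>)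
  have inner: "\<Sigma> p \<in> {ST<..<SB} \<and> \<pi> (\<Sigma> p) = p" if "p \<in> {P SB<..<P ST}" for p
  proof -
    have p: "p \<in> {P SB..P ST}" using that by auto
    have "\<pi> (\<sigma> p) = p" "\<sigma> p \<in> {ST..SB}" using \<pi>\<sigma>[OF p] \<sigma>_in[OF p] by auto
    moreover from this have "\<sigma> p \<noteq> ST" "\<sigma> p \<noteq> SB" using that ends by auto
    ultimately show ?thesis using \<Sigma>_eq[OF p] by auto
  qed
  show thesis
  proof (rule that[OF c\<Sigma> _ _ PP])
    show "\<Sigma> p = SB" if "p \<le> P SB" for p
      using that PP \<sigma>\<pi>[of SB] \<open>ST < SB\<close> ends by (simp add: \<Sigma>_def)
    show "\<Sigma> (P ST) = ST" using PP \<sigma>\<pi>[of ST] \<open>ST < SB\<close> ends by (simp add: \<Sigma>_def)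
    show "\<Sigma> p \<in> {ST<..<SB} \<and> P (\<Sigma> p) + u (\<Sigma> p) = p" if "p \<in> {P SB<..<P ST}" for p
      using inner[OF that] by (simp add: \<pi>_def)
    show "P S + u S \<in> {P SB<..<P ST} \<and> \<Sigma> (P S + u S) = S" if S: "S \<in> {ST<..<SB}" for S
    proof -
      have "\<pi> S \<in> {P SB<..<P ST}" using decr[of ST S] decr[of S SB] S ends by auto
      moreover have "\<Sigma> (\<pi> S) = S" using \<sigma>\<pi>[of S] \<Sigma>_eq[of "\<pi> S"] S calculation by auto
      ultimately show ?thesis by (simp add: \<pi>_def)
    qed
    show "(\<Sigma> has_real_derivative - (u (\<Sigma> p) / (e * g (\<Sigma> p)))) (at p)"
      if p: "p \<in> {P SB<..<P ST}" for p
    proof -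
      have S: "\<Sigma> p \<in> {ST<..<SB}" using inner[OF p] by simp
      have "(\<Sigma> has_real_derivative inverse (- (e * g (\<Sigma> p) / u (\<Sigma> p)))) (at p)"
        by (rule DERIV_inverse_function[where f = \<pi> and g = \<Sigma> and x = p and a = "P SB" and b = "P ST", OF d\<pi>[OF S]])
           (use p inner c\<Sigma> e g_pos[OF S] u_pos[OF S] in \<open>auto simp: continuous_on_eq_continuous_at\<close>)
      then show ?thesis by simp
    qed
  qed
qed

text \<open>The orbit for a general pressure velocity \<open>G\<close>, which is \<open>g(S)\<close> above the curve \<open>P\<close>. Pressure is used
as parameter; the speed \<open>V\<close> is at most linear near \<open>P(S\<^sub>T)\<close> since there \<open>g\<close> is at most, and the
remaining pressure difference at least, a multiple of \<open>S - S\<^sub>T\<close>. Near \<open>p\<^sub>B\<close> it is so either by assumption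
on the vertical line or, if \<open>p\<^sub>B = P(S\<^sub>B)\<close>, because \<open>g\<close> vanishes linearly at \<open>S\<^sub>B\<close>.\<close>

theorem drainage_connection:
  fixes P P' g :: "real \<Rightarrow> real" and G :: "real \<times> real \<Rightarrow> real"
  assumes "ST < SB" and e: "0 < e" and K: "0 < K" and b0: "0 < b0" and small: "4 * e * K \<le> b0\<^sup>2"
    and dP: "\<And>S. S \<in> {ST..SB} \<Longrightarrow> (P has_real_derivative P' S) (at S)"
    and cP': "continuous_on {ST..SB} P'" and P': "\<And>S. S \<in> {ST..SB} \<Longrightarrow> P' S \<le> - b0"
    and cg: "continuous_on {ST..SB} g" and g_pos: "\<And>S. S \<in> {ST<..<SB} \<Longrightarrow> 0 < g S"
    and g_le: "\<And>S. S \<in> {ST..SB} \<Longrightarrow> g S \<le> K * (S - ST)"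
    and "pB \<le> P SB"
    and cG: "continuous_on ({ST<..SB} \<times> {pB<..<P ST}) G"
    and G_drn: "\<And>S p. \<lbrakk>S \<in> {ST<..SB}; P S < p\<rbrakk> \<Longrightarrow> G (S, p) = g S"
    and G_pos: "\<And>p. \<lbrakk>pB < p; p \<le> P SB\<rbrakk> \<Longrightarrow> 0 < G (SB, p)"
    and A: "0 \<le> A"
    and G_le: "\<And>p. \<lbrakk>pB < p; p < P SB\<rbrakk> \<Longrightarrow> G (SB, p) \<le> A * (p - pB)"
    and g_le': "\<And>S. \<lbrakk>pB = P SB; S \<in> {ST..SB}\<rbrakk> \<Longrightarrow> g S \<le> A * (SB - S)"
  obtains S p Pr where
    "\<And>t. S t \<in> {ST<..SB} \<and> pB < p t \<and> p t < P ST \<and> (p t \<le> P SB \<longrightarrow> S t = SB) \<and>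
           (P SB < p t \<longrightarrow> P (S t) < p t)"
    and "\<And>t. (S has_real_derivative min 0 (P (S t) - p t) / e) (at t)"
    and "\<And>t. (p has_real_derivative G (S t, p t)) (at t)"
    and "(S \<longlongrightarrow> SB) at_bot" and "(p \<longlongrightarrow> pB) at_bot"
    and "(S \<longlongrightarrow> ST) at_top" and "(p \<longlongrightarrow> P ST) at_top"
    and "Pr ST = P ST"
    and "\<And>s. s \<in> {ST<..<SB} \<Longrightarrow> P s < Pr s \<and> (\<exists>t. S t = s) \<and> (\<forall>t. S t = s \<longrightarrow> p t = Pr s)"
    and "\<And>s. s \<in> {ST..<SB} \<Longrightarrow> \<bar>Pr s - P s\<bar> \<le> 2 * e * K / b0 * (s - ST)"
proof -
  obtain u where cu: "continuous_on {ST..SB} u" and uB: "u SB = 0"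
    and u_pos: "\<And>S. S \<in> {ST<..<SB} \<Longrightarrow> 0 < u S"
    and du: "\<And>S. S \<in> {ST<..<SB} \<Longrightarrow> (u has_real_derivative - (e * g S / u S) - P' S) (at S)"
    and u_le: "\<And>S. S \<in> {ST..SB} \<Longrightarrow> 0 \<le> u S \<and> u S \<le> 2 * e * K / b0 * (S - ST)"
    using overdamped_profile[OF \<open>ST < SB\<close> e K b0 small cP' P' cg g_pos g_le] by blast
  have uT: "u ST = 0" using u_le[of ST] \<open>ST < SB\<close> by simp
  obtain \<Sigma> where c\<Sigma>: "continuous_on UNIV \<Sigma>"
    and \<Sigma>B: "\<And>p. p \<le> P SB \<Longrightarrow> \<Sigma> p = SB" and \<Sigma>T: "\<Sigma> (P ST) = ST" and PP: "P SB < P ST"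
    and \<Sigma>1: "\<And>p. p \<in> {P SB<..<P ST} \<Longrightarrow> \<Sigma> p \<in> {ST<..<SB} \<and> P (\<Sigma> p) + u (\<Sigma> p) = p"
    and \<Sigma>2: "\<And>S. S \<in> {ST<..<SB} \<Longrightarrow> P S + u S \<in> {P SB<..<P ST} \<and> \<Sigma> (P S + u S) = S"
    and d\<Sigma>: "\<And>p. p \<in> {P SB<..<P ST} \<Longrightarrow>
           (\<Sigma> has_real_derivative - (u (\<Sigma> p) / (e * g (\<Sigma> p)))) (at p)"
    using saturation_as_function_of_pressure[OF \<open>ST < SB\<close> e dP g_pos cu uT uB u_pos du] by blast
  have P_decr: "P x - P y \<ge> b0 * (y - x)" if "ST \<le> x" "x \<le> y" "y \<le> SB" for x y
  proof -
    have "P y + b0 * y \<le> P x + b0 * x"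
    proof (rule DERIV_nonpos_imp_nonincreasing[where f = "\<lambda>x. P x + b0 * x"])
      fix z assume "x \<le> z" "z \<le> y"
      hence z: "z \<in> {ST..SB}" using that by auto
      show "\<exists>D. ((\<lambda>x. P x + b0 * x) has_real_derivative D) (at z) \<and> D \<le> 0"
        using P'[OF z] dP[OF z] by (intro exI[of _ "P' z + b0"]) (auto intro!: derivative_eq_intros)
    qed (use that in simp)
    then show ?thesis by (simp add: algebra_simps)
  qed
  define V where "V p = G (\<Sigma> p, p)" for p
  have \<Sigma>_in: "\<Sigma> p \<in> {ST<..SB}" if "p < P ST" for p
    using \<Sigma>B[of p] \<Sigma>1[of p] that \<open>ST < SB\<close> by (cases "p \<le> P SB") auto
  have cV: "continuous_on {pB<..<P ST} V"
    unfolding V_def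
    by (rule continuous_on_compose2[OF cG])
       (use \<Sigma>_in in \<open>auto intro!: continuous_intros continuous_on_subset[OF c\<Sigma>]\<close>)
  have V_drn: "V p = g (\<Sigma> p) \<and> P (\<Sigma> p) < p" if "p \<in> {P SB<..<P ST}" for p
    using \<Sigma>1[OF that] u_pos[of "\<Sigma> p"] G_drn[of "\<Sigma> p" p] by (auto simp: V_def)
  have V_pos: "0 < V p" if "pB < p" "p < P ST" for p
  proof (cases "p \<le> P SB")
    case True
    then show ?thesis using G_pos[OF that(1)] by (simp add: V_def \<Sigma>B)
  next
    case False
    then show ?thesis using V_drn[of p] g_pos[of "\<Sigma> p"] \<Sigma>1[of p] that by auto
  qed
  \<comment> \<open>\<open>u\<close> takes up at most half of \<open>P(S\<^sub>T) - P(S)\<close>, as \<open>2 e K / b\<^sub>0 \<le> b\<^sub>0 / 2\<close>\<close>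
  have hi: "V p \<le> (2 * K / b0) * (P ST - p)" if "P SB < p" "p < P ST" for p
  proof -
    define S where "S = \<Sigma> p"
    have S: "ST < S" "S < SB" "P S + u S = p" using \<Sigma>1[of p] that by (auto simp: S_def)
    have "2 * e * K / b0 \<le> b0 / 2" using small b0 by (simp add: field_simps power2_eq_square)
    hence "2 * e * K / b0 * (S - ST) \<le> b0 / 2 * (S - ST)" using S by (intro mult_right_mono) auto
    hence "u S \<le> b0 / 2 * (S - ST)" using u_le[of S] S by auto
    moreover have "b0 * (S - ST) \<le> P ST - P S" using P_decr[of ST S] S by simp
    ultimately have "b0 / 2 * (S - ST) \<le> P ST - p" using S(3) by (simp add: field_simps)
    hence "(2 * K / b0) * (b0 / 2 * (S - ST)) \<le> (2 * K / b0) * (P ST - p)"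
      using K b0 by (intro mult_left_mono) auto
    moreover have "V p \<le> K * (S - ST)" using V_drn[of p] g_le[of S] S that by (simp add: S_def)
    ultimately show ?thesis using b0 by simp
  qed
  obtain m A' where m: "pB < m" and lo: "\<And>p. \<lbrakk>pB < p; p < m\<rbrakk> \<Longrightarrow> V p \<le> A' * (p - pB)"
  proof (cases "pB < P SB")
    case True
    show thesis by (rule that[OF True, of A]) (use G_le \<Sigma>B in \<open>auto simp: V_def\<close>)
  next
    case False
    hence eq: "pB = P SB" using \<open>pB \<le> P SB\<close> by simp
    show thesis
    proof (rule that[of "P ST" "A / b0"])
      show "pB < P ST" using eq PP by simp
      fix p assume p: "pB < p" "p < P ST"
      define S where "S = \<Sigma> p"
      have S: "ST < S" "S < SB" "P S + u S = p" using \<Sigma>1[of p] p eq by (auto simp: S_def)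
      have "b0 * (SB - S) \<le> P S - P SB" using P_decr[of S SB] S by simp
      hence "b0 * (SB - S) \<le> p - pB" using S(3) u_pos[of S] S eq by simp
      hence "(A / b0) * (b0 * (SB - S)) \<le> (A / b0) * (p - pB)" using A b0 by (intro mult_left_mono) auto
      moreover have "V p \<le> A * (SB - S)"
        using V_drn[of p] g_le'[OF eq, of S] S p eq by (simp add: S_def)
      ultimately show "V p \<le> A / b0 * (p - pB)" using b0 by simp
    qed
  qed
  have "pB < P ST" using \<open>pB \<le> P SB\<close> PP by simp
  obtain q where q: "\<And>t. pB < q t \<and> q t < P ST"
    and dq: "\<And>t. (q has_real_derivative V (q t)) (at t)"
    and qB: "(q \<longlongrightarrow> pB) at_bot" and qT: "(q \<longlongrightarrow> P ST) at_top"
    and q_surj: "\<And>p. \<lbrakk>pB < p; p < P ST\<rbrakk> \<Longrightarrow> \<exists>t. q t = p"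
    using autonomous_connection[OF \<open>pB < P ST\<close> cV V_pos m lo PP hi] by blast
  have ct\<Sigma>: "isCont \<Sigma> p" for p using c\<Sigma> by (simp add: continuous_on_eq_continuous_at)
  \<comment> \<open>the slope \<open>dS/dp = S' / p'\<close> of the orbit; it is continuous across \<open>P(S\<^sub>B)\<close>, where the vertical part
    joins the drainage part: both one-sided slopes are \<open>0\<close>, as \<open>u\<close> vanishes there while \<open>V\<close> does not\<close>
  define D where "D p = min 0 (P (\<Sigma> p) - p) / (e * V p)" for p
  have D0: "D p = 0" if "p \<le> P SB" for p using that \<Sigma>B by (simp add: D_def)
  have below: "(\<Sigma> has_real_derivative D p) (at p)" if "p < P SB" for p
  proof -
    have "((\<lambda>_. SB) has_real_derivative 0) (at p)" by simp
    then have "(\<Sigma> has_real_derivative 0) (at p)"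
      by (rule has_field_derivative_transform_within_open[where S = "{..<P SB}"])
         (use that \<Sigma>B in auto)
    then show ?thesis using D0[of p] that by simp
  qed
  have above: "(\<Sigma> has_real_derivative D p) (at p)" if "p \<in> {P SB<..<P ST}" for p
  proof -
    have "P (\<Sigma> p) - p = - u (\<Sigma> p)" using \<Sigma>1[OF that] by linarith
    with d\<Sigma>[OF that] V_drn[OF that] show ?thesis by (simp add: D_def)
  qed
  have junction: "(\<Sigma> has_real_derivative D (P SB)) (at (P SB))" if "pB < P SB"
  proof (rule has_real_derivative_if_derivative_continuous[OF ct\<Sigma>])
    have "isCont V (P SB)"
      using cV that PP by (simp add: continuous_on_eq_continuous_at)
    moreover have "isCont (\<lambda>p. P (\<Sigma> p)) (P SB)"
    proof (rule isCont_o2[OF ct\<Sigma>])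
      show "isCont P (\<Sigma> (P SB))" using DERIV_isCont[OF dP[of SB]] \<Sigma>B[of "P SB"] \<open>ST < SB\<close> by simp
    qed
    moreover have "V (P SB) \<noteq> 0" using V_pos[of "P SB"] that PP by simp
    ultimately show "isCont D (P SB)"
      unfolding D_def using e by (intro continuous_intros) auto
    have "\<forall>\<^sub>F p in at (P SB). p < P ST"
      using order_tendstoD(2)[OF tendsto_ident_at PP] .
    then show "\<forall>\<^sub>F p in at (P SB). (\<Sigma> has_real_derivative D p) (at p)"
      using eventually_neq_at_within[of "P SB" "P SB"]
    proof eventually_elim
      case (elim p)
      then show ?case using below[of p] above[of p] by (cases "p < P SB") auto
    qed
  qed
  have D: "(\<Sigma> has_real_derivative D p) (at p)" if "pB < p" "p < P ST" for p
    using below[of p] above[of p] junction that by (cases p "P SB" rule: linorder_cases) auto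
  show thesis
  proof (rule that[of "\<lambda>t. \<Sigma> (q t)" q "\<lambda>s. P s + u s"])
    show "\<Sigma> (q t) \<in> {ST<..SB} \<and> pB < q t \<and> q t < P ST \<and> (q t \<le> P SB \<longrightarrow> \<Sigma> (q t) = SB) \<and>
        (P SB < q t \<longrightarrow> P (\<Sigma> (q t)) < q t)" for t
      using q[of t] \<Sigma>_in[of "q t"] \<Sigma>B[of "q t"] V_drn[of "q t"] by auto
    show "((\<lambda>t. \<Sigma> (q t)) has_real_derivative min 0 (P (\<Sigma> (q t)) - q t) / e) (at t)" for t
    proof -
      have "((\<lambda>t. \<Sigma> (q t)) has_real_derivative D (q t) * V (q t)) (at t)"
        by (rule DERIV_chain2[OF D dq]) (use q in auto)
      moreover have "V (q t) \<noteq> 0" using V_pos[of "q t"] q[of t] by auto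
      ultimately show ?thesis by (simp add: D_def)
    qed
    show "(q has_real_derivative G (\<Sigma> (q t), q t)) (at t)" for t
      using dq by (simp add: V_def)
    show "((\<lambda>t. \<Sigma> (q t)) \<longlongrightarrow> SB) at_bot"
      using isCont_tendsto_compose[OF ct\<Sigma> qB] \<Sigma>B[OF \<open>pB \<le> P SB\<close>] by simp
    show "((\<lambda>t. \<Sigma> (q t)) \<longlongrightarrow> ST) at_top"
      using isCont_tendsto_compose[OF ct\<Sigma> qT] \<Sigma>T by simp
    show "P s < P s + u s \<and> (\<exists>t. \<Sigma> (q t) = s) \<and> (\<forall>t. \<Sigma> (q t) = s \<longrightarrow> q t = P s + u s)"
      if s: "s \<in> {ST<..<SB}" for s
    proof (intro conjI allI impI)
      show "P s < P s + u s" using u_pos[OF s] by simp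
      have "pB < P s + u s" "P s + u s < P ST" using \<Sigma>2[OF s] \<open>pB \<le> P SB\<close> by auto
      from q_surj[OF this] show "\<exists>t. \<Sigma> (q t) = s" using \<Sigma>2[OF s] by metis
      fix t assume t: "\<Sigma> (q t) = s"
      hence "q t \<in> {P SB<..<P ST}" using \<Sigma>B[of "q t"] q[of t] s by force
      from \<Sigma>1[OF this] t show "q t = P s + u s" by simp
    qed
    show "\<bar>P s + u s - P s\<bar> \<le> 2 * e * K / b0 * (s - ST)" if "s \<in> {ST..<SB}" for s
      using u_le[of s] that by auto
  qed (use qB qT uT in auto)
qed

section \<open>Chords from a tangent point of a convex-concave graph\<close>

text \<open>Let \<open>m x\<close> be the slope of the chord from \<open>(S\<^sub>B, F\<^sub>B)\<close> to \<open>(x, F x)\<close>. Its derivative has the sign of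
\<open>n x = F\<^sub>B - F x - F' x (S\<^sub>B - x)\<close>, which compares \<open>F\<^sub>B\<close> with the value at \<open>S\<^sub>B\<close> of the
tangent at \<open>x\<close>. Now \<open>n' = - F'' (S\<^sub>B - x)\<close>, so
\<open>n\<close> first decreases from \<open>n S\<^sub>b = 0\<close> and then increases to \<open>n S\<^sub>B \<le> 0\<close>: it is negative in between.
Hence \<open>m\<close> is strictly decreasing, and the graph stays above the chord drawn to an earlier point.\<close>

lemma graph_above_chord:
  fixes F F' F'' :: "real \<Rightarrow> real"
  assumes cF: "continuous_on {Sb..SB} F" and cF': "continuous_on {Sb..SB} F'"
    and dF: "\<And>x. x \<in> {Sb<..<SB} \<Longrightarrow> (F has_real_derivative F' x) (at x)"
    and dF': "\<And>x. x \<in> {Sb<..<SB} \<Longrightarrow> (F' has_real_derivative F'' x) (at x)"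
    and convex: "\<And>x. \<lbrakk>x \<in> {Sb<..<SB}; x < a\<rbrakk> \<Longrightarrow> 0 < F'' x"
    and concave: "\<And>x. \<lbrakk>x \<in> {Sb<..<SB}; a < x\<rbrakk> \<Longrightarrow> F'' x < 0"
    and tangent: "FB = F Sb + F' Sb * (SB - Sb)" and above: "FB \<le> F SB"
    and ST: "Sb \<le> ST" "ST < S" "S < SB"
  shows "FB + (F ST - FB) / (ST - SB) * (S - SB) < F S"
proof -
  define n where "n x = FB - F x - F' x * (SB - x)" for x
  have cn: "continuous_on {Sb..SB} n" unfolding n_def by (intro continuous_intros cF cF')
  have dn: "(n has_real_derivative - (F'' x * (SB - x))) (at x)" if "x \<in> {Sb<..<SB}" for x
    unfolding n_def using dF[OF that] dF'[OF that] by (auto intro!: derivative_eq_intros)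
  have n_neg: "n x < 0" if x: "Sb < x" "x < SB" for x
  proof (cases "x \<le> a")
    case True
    have "n x < n Sb"
    proof (rule DERIV_neg_imp_decreasing_open[OF x(1), where f = n])
      fix y assume y: "Sb < y" "y < x"
      hence y': "y \<in> {Sb<..<SB}" using x by auto
      show "\<exists>D. (n has_real_derivative D) (at y) \<and> D < 0"
        using dn[OF y'] convex[OF y'] y y' True by (intro exI[of _ "- (F'' y * (SB - y))"]) auto
    qed (rule continuous_on_subset[OF cn], use x in auto)
    then show ?thesis using tangent by (simp add: n_def)
  next
    case False
    have "n x < n SB"
    proof (rule DERIV_pos_imp_increasing_open[OF x(2), where f = n])
      fix y assume y: "x < y" "y < SB"
      hence y': "y \<in> {Sb<..<SB}" using x by auto
      show "\<exists>D. (n has_real_derivative D) (at y) \<and> 0 < D"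
        using dn[OF y'] concave[OF y'] y y' False
        by (intro exI[of _ "- (F'' y * (SB - y))"]) (auto simp: mult_neg_pos)
    qed (rule continuous_on_subset[OF cn], use x in auto)
    then show ?thesis using above by (simp add: n_def)
  qed
  define m where "m x = (FB - F x) / (SB - x)" for x
  have "m S < m ST"
  proof (rule DERIV_neg_imp_decreasing_open[OF \<open>ST < S\<close>, where f = m])
    fix x assume "ST < x" "x < S"
    hence x: "Sb < x" "x < SB" using ST by auto
    have "(m has_real_derivative n x / (SB - x)\<^sup>2) (at x)"
      unfolding m_def n_def using dF[of x] x
      by (auto intro!: derivative_eq_intros simp: power2_eq_square)
    moreover have "n x / (SB - x)\<^sup>2 < 0" using n_neg[OF x] x by (simp add: divide_neg_pos)
    ultimately show "\<exists>D. (m has_real_derivative D) (at x) \<and> D < 0" by blast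
  next
    show "continuous_on {ST..S} m"
      unfolding m_def
      by (intro continuous_intros continuous_on_subset[OF cF]) (use ST in auto)
  qed
  hence "FB - F S < m ST * (SB - S)" using ST by (simp add: m_def pos_divide_less_eq)
  moreover define c where "c = (F ST - FB) / (ST - SB)"
  have "m ST = c"
    unfolding m_def c_def by (metis minus_diff_eq minus_divide_divide)
  ultimately show ?thesis unfolding c_def[symmetric] by (simp add: algebra_simps)
qed

section \<open>Regularity and sign of the constitutive functions\<close>

lemma has_real_derivative_deriv_within:
  assumes "C1_on A u" and "x \<in> A"
  shows "(u has_real_derivative deriv_within A u x) (at x within A)"
  using assms
  by (simp add: C1_on_def differentiable_on_def deriv_within_def
      has_real_derivative_iff_has_vector_derivative vector_derivative_works[symmetric])

lemma has_real_derivative_deriv_within_interior: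
  assumes "C1_on A u" and "x \<in> interior A"
  shows "(u has_real_derivative deriv_within A u x) (at x)"
  using has_real_derivative_deriv_within[OF assms(1), of x] assms(2) interior_subset[of A]
    at_within_interior[OF assms(2)] by auto

lemma mem_reg_all: "(S, p) \<in> reg_all X \<longleftrightarrow> 0 < S \<and> S \<le> 1"
  by (auto simp: reg_all_def reg_imb_def reg_hyst_def reg_drn_def)

lemma krw_pos:
  assumes "permeability_ok X" and "0 < S" "S \<le> 1"
  shows "0 < krw X j S"
proof -
  have C1: "C1_on {0..1} (krw X j)" and k0: "krw X j 0 = 0"
    and pos: "\<And>x. x \<in> {0<..1} \<Longrightarrow> 0 < deriv_within {0..1} (krw X j) x"
    using assms(1) by (auto simp: permeability_ok_def C2_on_def)
  have "krw X j 0 < krw X j S"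
  proof (rule DERIV_pos_imp_increasing_open[OF \<open>0 < S\<close>])
    fix x assume "0 < x" "x < S"
    then show "\<exists>D. (krw X j has_real_derivative D) (at x) \<and> 0 < D"
      using has_real_derivative_deriv_within_interior[OF C1, of x] pos[of x] \<open>S \<le> 1\<close> by auto
  next
    show "continuous_on {0..S} (krw X j)"
      by (rule continuous_on_subset[OF DERIV_continuous_on[OF has_real_derivative_deriv_within[OF C1]]])
         (use \<open>S \<le> 1\<close> in auto)
  qed
  with k0 show ?thesis by simp
qed

lemma krn_pos:
  assumes "permeability_ok X" and "0 \<le> S" "S < 1"
  shows "0 < krn X j S"
proof -
  have C1: "C1_on {0..1} (krn X j)" and k1: "krn X j 1 = 0"
    and neg: "\<And>x. x \<in> {0..<1} \<Longrightarrow> deriv_within {0..1} (krn X j) x < 0"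
    using assms(1) by (auto simp: permeability_ok_def C2_on_def)
  have "krn X j 1 < krn X j S"
  proof (rule DERIV_neg_imp_decreasing_open[OF \<open>S < 1\<close>])
    fix x assume "S < x" "x < 1"
    then show "\<exists>D. (krn X j has_real_derivative D) (at x) \<and> D < 0"
      using has_real_derivative_deriv_within_interior[OF C1, of x] neg[of x] \<open>0 \<le> S\<close> by auto
  next
    show "continuous_on {S..1} (krn X j)"
      by (rule continuous_on_subset[OF DERIV_continuous_on[OF has_real_derivative_deriv_within[OF C1]]])
         (use \<open>0 \<le> S\<close> in auto)
  qed
  with k1 show ?thesis by simp
qed

text \<open>A glued function takes its drainage value strictly above the curve, and on the curve the value
prescribed inside the hysteresis region; continuity makes them agree.\<close>

lemma glue_at_drainage_curve:
  assumes cont: "continuous_on (reg_all X) (glue X k kb)" and S: "0 < S" "S \<le> 1"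
  shows "glue X k kb (S, pc X Drn S) = k Drn S"
proof -
  have "(\<lambda>n. pc X Drn S + 1 / real (Suc n)) \<longlonglongrightarrow> pc X Drn S + 0"
    by (intro tendsto_intros lim_1_over_n[THEN LIMSEQ_Suc])
  hence "(\<lambda>n. (S, pc X Drn S + 1 / real (Suc n))) \<longlonglongrightarrow> (S, pc X Drn S)"
    by (intro tendsto_intros) simp
  from continuous_on_tendsto_compose[OF cont this]
  have "(\<lambda>n. glue X k kb (S, pc X Drn S + 1 / real (Suc n))) \<longlonglongrightarrow> glue X k kb (S, pc X Drn S)"
    using S by (simp add: mem_reg_all)
  moreover have "glue X k kb (S, pc X Drn S + 1 / real (Suc n)) = k Drn S" for n
    using S by (simp add: glue_def reg_drn_def)
  ultimately show ?thesis by (simp add: LIMSEQ_const_iff)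
qed

lemma glue_at_imbibition_curve:
  assumes cont: "continuous_on (reg_all X) (glue X k kb)" and S: "0 < S" "S \<le> 1"
    and le: "pc X Imb S \<le> pc X Drn S"
  shows "glue X k kb (S, pc X Imb S) = k Imb S"
proof -
  have "(\<lambda>n. pc X Imb S - 1 / real (Suc n)) \<longlonglongrightarrow> pc X Imb S - 0"
    by (intro tendsto_intros lim_1_over_n[THEN LIMSEQ_Suc])
  hence "(\<lambda>n. (S, pc X Imb S - 1 / real (Suc n))) \<longlonglongrightarrow> (S, pc X Imb S)"
    by (intro tendsto_intros) simp
  from continuous_on_tendsto_compose[OF cont this]
  have "(\<lambda>n. glue X k kb (S, pc X Imb S - 1 / real (Suc n))) \<longlonglongrightarrow> glue X k kb (S, pc X Imb S)"
    using S by (simp add: mem_reg_all)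
  moreover have "glue X k kb (S, q) = k Imb S" if "q < pc X Imb S" for q
    using that le by (auto simp: glue_def reg_drn_def reg_hyst_def)
  hence "glue X k kb (S, pc X Imb S - 1 / real (Suc n)) = k Imb S" for n by simp
  ultimately show ?thesis by (simp add: LIMSEQ_const_iff)
qed

lemma glue_drainage:
  assumes "continuous_on (reg_all X) (glue X k kb)" and "0 < S" "S \<le> 1" and "pc X Drn S \<le> p"
  shows "glue X k kb (S, p) = k Drn S"
proof (cases "p = pc X Drn S")
  case True
  then show ?thesis using glue_at_drainage_curve[OF assms(1-3)] by simp
next
  case False
  then show ?thesis using assms by (simp add: glue_def reg_drn_def)
qed

lemma gradient_along_pressure:
  assumes grad: "has_C1_gradient u g (reg_hyst X)" and S: "0 < S" "S \<le> 1"
    and p: "p \<in> {pc X Imb S..pc X Drn S}"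
  shows "((\<lambda>p. u (S, p)) has_real_derivative snd (g (S, p))) (at p within {pc X Imb S..pc X Drn S})"
proof -
  let ?I = "{pc X Imb S..pc X Drn S}"
  have sub: "Pair S ` ?I \<subseteq> reg_hyst X" using S by (auto simp: reg_hyst_def)
  have "(u has_derivative (\<lambda>v. g (S, p) \<bullet> v)) (at (S, p) within Pair S ` ?I)"
    using grad p S unfolding has_C1_gradient_def
    by (intro has_derivative_subset[OF _ sub]) (auto simp: reg_hyst_def)
  moreover have "(Pair S has_derivative (\<lambda>v. (0, v))) (at p within ?I)"
    by (auto intro!: derivative_eq_intros has_derivative_Pair)
  ultimately have "((\<lambda>p. u (S, p)) has_derivative (\<lambda>v. g (S, p) \<bullet> (0, v))) (at p within ?I)"
    by (rule has_derivative_in_compose[rotated])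
  then show ?thesis
    by (simp add: has_field_derivative_def inner_prod_def inner_real_def mult.commute[of _ "snd (g (S, p))"])
qed

lemma strict_increase_within_Icc:
  fixes f f' :: "real \<Rightarrow> real"
  assumes "\<And>x. x \<in> {a..b} \<Longrightarrow> (f has_real_derivative f' x) (at x within {a..b})"
    and "\<And>x. x \<in> {a..b} \<Longrightarrow> 0 < f' x" and "a \<le> x" "x < y" "y \<le> b"
  shows "f x < f y"
proof (rule DERIV_pos_imp_increasing_open[OF \<open>x < y\<close>])
  fix z assume "x < z" "z < y"
  then show "\<exists>D. (f has_real_derivative D) (at z) \<and> 0 < D"
    using assms(1)[of z] assms(2)[of z] assms(3-5) at_within_Icc_at[of a z b] by auto
next
  show "continuous_on {x..y} f"
    by (rule continuous_on_subset[OF DERIV_continuous_on[OF assms(1)]]) (use assms(3-5) in auto)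
qed

text \<open>In the hysteresis region the relative permeability increases with pressure from its positive
value on the imbibition curve.\<close>

lemma kw_pos:
  assumes X: "hysteretic_flow X" and S: "0 < S" "S < 1"
  shows "0 < kw X (S, p)"
proof -
  have perm: "permeability_ok X" and lt: "pc X Imb S < pc X Drn S"
    using X S by (auto simp: hysteretic_flow_def capillary_ok_def)
  have cont: "continuous_on (reg_all X) (glue X (krw X) (krw_bar X))"
    using perm by (simp add: permeability_ok_def kw_def)
  obtain g where g: "has_C1_gradient (krw_bar X) g (reg_hyst X)"
    and g_pos: "\<And>x. x \<in> reg_hyst X \<Longrightarrow> 0 < snd (g x)"
    using perm by (auto simp: permeability_ok_def has_C2_gradient_def)
  consider "p < pc X Imb S" | "pc X Drn S < p" | "p \<in> {pc X Imb S..pc X Drn S}" by force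
  then show ?thesis
  proof cases
    case 1
    then show ?thesis
      using lt krw_pos[OF perm, of S Imb] S by (auto simp: kw_def glue_def reg_drn_def reg_hyst_def)
  next
    case 2
    then show ?thesis using krw_pos[OF perm, of S Drn] S by (simp add: kw_def glue_def reg_drn_def)
  next
    case 3
    have bar: "kw X (S, q) = krw_bar X (S, q)" if "q \<in> {pc X Imb S..pc X Drn S}" for q
      using that S by (auto simp: kw_def glue_def reg_drn_def reg_hyst_def)
    have "krw_bar X (S, pc X Imb S) \<le> krw_bar X (S, p)"
    proof (cases "p = pc X Imb S")
      case False
      have "krw_bar X (S, pc X Imb S) < krw_bar X (S, p)"
        by (rule strict_increase_within_Icc[where f = "\<lambda>p. krw_bar X (S, p)", OF gradient_along_pressure[OF g]])
           (use S 3 False g_pos in \<open>auto simp: reg_hyst_def\<close>)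
      then show ?thesis by simp
    qed simp
    moreover have "krw_bar X (S, pc X Imb S) = krw X Imb S"
      using glue_at_imbibition_curve[OF cont] bar[of "pc X Imb S"] S lt by (simp add: kw_def)
    ultimately show ?thesis using bar[OF 3] krw_pos[OF perm, of S Imb] S by simp
  qed
qed

text \<open>In the hysteresis region the relative permeability decreases with pressure to its positive
value on the drainage curve.\<close>

lemma kn_pos:
  assumes X: "hysteretic_flow X" and S: "0 < S" "S < 1"
  shows "0 < kn X (S, p)"
proof -
  have perm: "permeability_ok X" and lt: "pc X Imb S < pc X Drn S"
    using X S by (auto simp: hysteretic_flow_def capillary_ok_def)
  have cont: "continuous_on (reg_all X) (glue X (krn X) (krn_bar X))"
    using perm by (simp add: permeability_ok_def kn_def)
  obtain g where g: "has_C1_gradient (krn_bar X) g (reg_hyst X)"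
    and g_neg: "\<And>x. x \<in> reg_hyst X \<Longrightarrow> snd (g x) < 0"
    using perm by (auto simp: permeability_ok_def has_C2_gradient_def)
  consider "p < pc X Imb S" | "pc X Drn S \<le> p" | "p \<in> {pc X Imb S..<pc X Drn S}" by force
  then show ?thesis
  proof cases
    case 1
    then show ?thesis
      using lt krn_pos[OF perm, of S Imb] S by (auto simp: kn_def glue_def reg_drn_def reg_hyst_def)
  next
    case 2
    then show ?thesis
      using glue_drainage[OF cont, of S p] krn_pos[OF perm, of S Drn] S by (simp add: kn_def)
  next
    case 3
    have "- krn_bar X (S, p) < - krn_bar X (S, pc X Drn S)"
      by (rule strict_increase_within_Icc[where f = "\<lambda>p. - krn_bar X (S, p)",
            OF DERIV_minus[OF gradient_along_pressure[OF g]]])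
         (use S 3 g_neg in \<open>auto simp: reg_hyst_def\<close>)
    moreover have "krn_bar X (S, pc X Drn S) = krn X Drn S"
      using glue_at_drainage_curve[OF cont S(1)] S lt by (simp add: glue_def reg_drn_def reg_hyst_def)
    moreover have "kn X (S, p) = krn_bar X (S, p)"
      using 3 S by (auto simp: kn_def glue_def reg_drn_def reg_hyst_def)
    ultimately show ?thesis using krn_pos[OF perm, of S Drn] S by simp
  qed
qed

lemma flux_drainage:
  assumes X: "hysteretic_flow X" and S: "0 < S" "S < 1" and "pc X Drn S \<le> p"
  shows "flux X (S, p) = flux_br X Drn S"
    and "grav_h X (S, p) = krn X Drn S * (krw X Drn S / (krw X Drn S + visc_ratio X * krn X Drn S))"
proof -
  have "continuous_on (reg_all X) (kw X)" "continuous_on (reg_all X) (kn X)"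
    using X by (auto simp: hysteretic_flow_def permeability_ok_def)
  hence "kw X (S, p) = krw X Drn S" "kn X (S, p) = krn X Drn S"
    using glue_drainage S \<open>pc X Drn S \<le> p\<close> by (auto simp: kw_def kn_def)
  then show "flux X (S, p) = flux_br X Drn S"
    and "grav_h X (S, p) = krn X Drn S * (krw X Drn S / (krw X Drn S + visc_ratio X * krn X Drn S))"
    by (auto simp: flux_def flux_br_def grav_h_def frac_flow_def Let_def)
qed

lemma grav_h_pos:
  assumes X: "hysteretic_flow X" and S: "0 < S" "S < 1"
  shows "0 < grav_h X (S, p)"
proof -
  have "0 < visc_ratio X" using X by (simp add: hysteretic_flow_def)
  then show ?thesis
    using kw_pos[OF assms, of p] kn_pos[OF assms, of p]
    by (auto simp: grav_h_def frac_flow_def intro!: mult_pos_pos divide_pos_pos add_pos_pos)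
qed

lemma continuous_grav_h:
  assumes X: "hysteretic_flow X" and A: "A \<subseteq> {0<..<1} \<times> UNIV"
  shows "continuous_on A (grav_h X)"
proof -
  have sub: "A \<subseteq> reg_all X" using A by (force simp: mem_reg_all)
  have c: "continuous_on A (kw X)" "continuous_on A (kn X)"
    using X by (auto simp: hysteretic_flow_def permeability_ok_def intro: continuous_on_subset[OF _ sub])
  have "kw X x + visc_ratio X * kn X x \<noteq> 0" if "x \<in> A" for x
  proof -
    have "x = (fst x, snd x)" "0 < fst x" "fst x < 1" using A that by auto
    hence "0 < kw X x" "0 < kn X x" using kw_pos[OF X] kn_pos[OF X] by metis+
    moreover have "0 < visc_ratio X" using X by (simp add: hysteretic_flow_def)
    ultimately have "0 < kw X x + visc_ratio X * kn X x" by (intro add_pos_pos mult_pos_pos)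
    then show ?thesis by simp
  qed
  then show ?thesis
    unfolding grav_h_def frac_flow_def by (intro continuous_intros c) auto
qed

lemma continuous_TW_G:
  assumes X: "hysteretic_flow X" and A: "A \<subseteq> {0<..<1} \<times> UNIV"
  shows "continuous_on A (TW_G X EB ET)"
proof -
  have sub: "A \<subseteq> reg_all X" using A by (force simp: mem_reg_all)
  have cF: "continuous_on A (flux X)"
    using X by (auto simp: hysteretic_flow_def flux_ok_def intro: continuous_on_subset[OF _ sub])
  have "grav_h X x \<noteq> 0" if "x \<in> A" for x
  proof -
    have "x = (fst x, snd x)" "0 < fst x" "fst x < 1" using A that by auto
    then show ?thesis using grav_h_pos[OF X] by (metis less_irrefl)
  qed
  then show ?thesis
    unfolding TW_G_def chord_def by (intro continuous_intros cF continuous_grav_h[OF X A]) auto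
qed

lemma flux_pressure_derivative:
  assumes X: "hysteretic_flow X" and S: "0 < S" "S < 1"
  shows "\<exists>D. (\<forall>p\<in>{pc X Imb S..pc X Drn S}. 0 < D p \<and>
      ((\<lambda>p. flux X (S, p)) has_real_derivative D p) (at p within {pc X Imb S..pc X Drn S})) \<and>
    continuous_on {pc X Imb S..pc X Drn S} D"
proof -
  obtain g where g: "has_C1_gradient (flux X) g (reg_hyst X)"
    and g_pos: "\<And>x. x \<in> reg_hyst X \<Longrightarrow> 0 < snd (g x)"
    using X by (auto simp: hysteretic_flow_def flux_ok_def has_C2_gradient_def)
  show ?thesis
  proof (intro exI[of _ "\<lambda>p. snd (g (S, p))"] conjI ballI)
    fix p assume p: "p \<in> {pc X Imb S..pc X Drn S}"
    show "0 < snd (g (S, p))" using g_pos[of "(S, p)"] S p by (simp add: reg_hyst_def)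
    show "((\<lambda>p. flux X (S, p)) has_real_derivative snd (g (S, p)))
        (at p within {pc X Imb S..pc X Drn S})"
      using gradient_along_pressure[OF g _ _ p] S by simp
  next
    have cg: "continuous_on (reg_hyst X) g" using g by (simp add: has_C1_gradient_def)
    have "continuous_on {pc X Imb S..pc X Drn S} (\<lambda>p. g (S, p))"
    proof (rule continuous_on_compose2[OF cg])
      show "continuous_on {pc X Imb S..pc X Drn S} (Pair S)"
        by (intro continuous_intros)
      show "Pair S ` {pc X Imb S..pc X Drn S} \<subseteq> reg_hyst X"
        using S by (auto simp: reg_hyst_def)
    qed
    then show "continuous_on {pc X Imb S..pc X Drn S} (\<lambda>p. snd (g (S, p)))"
      by (rule continuous_on_snd)
  qed
qed

lemma flux_increasing_in_pressure:
  assumes X: "hysteretic_flow X" and S: "0 < S" "S < 1"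
    and p: "pc X Imb S \<le> p" "p < p'" "p' \<le> pc X Drn S"
  shows "flux X (S, p) < flux X (S, p')"
proof -
  obtain D where "\<forall>p\<in>{pc X Imb S..pc X Drn S}. 0 < D p \<and>
      ((\<lambda>p. flux X (S, p)) has_real_derivative D p) (at p within {pc X Imb S..pc X Drn S})"
    using flux_pressure_derivative[OF X S] by (elim exE conjE)
  note D = this[rule_format]
  show ?thesis
    by (rule strict_increase_within_Icc[where f = "\<lambda>p. flux X (S, p)" and f' = D,
          OF D[THEN conjunct2] D[THEN conjunct1] p])
qed

text \<open>Since \<open>S\<^sub>T < S\<^sub>B\<close> rules out \<open>S\<^sub>b = S\<^sub>B\<close>, the point \<open>S\<^sub>b\<close> is a genuine tangent point; moreover
\<open>F(S\<^sub>B, p\<^sub>B) \<le> F\<^sup>(\<^sup>d\<^sup>)(S\<^sub>B)\<close> because the flux increases with pressure up to the drainage curve.\<close>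

lemma drainage_flux_above_chord:
  assumes X: "hysteretic_flow X" and SB: "0 < SB" "SB < 1"
    and pB: "pB \<in> {pc X Imb SB..pc X Drn SB}"
    and Sb: "drainage_tangent_point X SB pB Sb" and ST: "ST \<in> {Sb..<SB}"
    and S: "ST < S" "S < SB"
  shows "flux X (SB, pB) + (flux_br X Drn ST - flux X (SB, pB)) / (ST - SB) * (S - SB)
    < flux_br X Drn S"
proof -
  let ?F = "flux_br X Drn"
  let ?F' = "deriv_within {0..1} ?F"
  let ?F'' = "deriv_within {0..1} ?F'"
  have "Sb \<noteq> SB" using ST by auto
  hence Sb0: "0 \<le> Sb" and Sb_tan: "flux X (SB, pB) = ?F Sb + ?F' Sb * (SB - Sb)"
    using Sb by (auto simp: drainage_tangent_point_def split: if_splits)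
  have C: "C1_on {0..1} ?F" "C1_on {0..1} ?F'"
    using X by (auto simp: hysteretic_flow_def flux_ok_def C2_on_def)
  obtain a where a: "\<And>x. x \<in> {0<..<a} \<Longrightarrow> 0 < ?F'' x" "\<And>x. x \<in> {a<..<1} \<Longrightarrow> ?F'' x < 0"
    using X unfolding hysteretic_flow_def flux_ok_def by blast
  have sub: "{Sb..SB} \<subseteq> {0..1}" using Sb0 SB by auto
  show ?thesis
  proof (rule graph_above_chord[where F = ?F and F' = ?F' and F'' = ?F'' and a = a and Sb = Sb])
    show "continuous_on {Sb..SB} ?F"
      by (rule continuous_on_subset[OF DERIV_continuous_on[OF has_real_derivative_deriv_within[OF C(1)]] sub])
    show "continuous_on {Sb..SB} ?F'"
      by (rule continuous_on_subset[OF DERIV_continuous_on[OF has_real_derivative_deriv_within[OF C(2)]] sub])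
    show "(?F has_real_derivative ?F' x) (at x)" "(?F' has_real_derivative ?F'' x) (at x)"
      if "x \<in> {Sb<..<SB}" for x
    proof -
      have x: "x \<in> interior {0..1}" using that Sb0 SB by simp
      show "(?F has_real_derivative ?F' x) (at x)" "(?F' has_real_derivative ?F'' x) (at x)"
        using has_real_derivative_deriv_within_interior[OF C(1) x]
          has_real_derivative_deriv_within_interior[OF C(2) x] by blast+
    qed
    show "flux X (SB, pB) \<le> ?F SB"
    proof (cases "pB = pc X Drn SB")
      case True
      then show ?thesis using flux_drainage(1)[OF X SB, of pB] by simp
    next
      case False
      then show ?thesis
        using flux_increasing_in_pressure[OF X SB, of pB "pc X Drn SB"] flux_drainage(1)[OF X SB, of "pc X Drn SB"] pB
        by simp
    qed
    show "flux X (SB, pB) = ?F Sb + ?F' Sb * (SB - Sb)" by (rule Sb_tan)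
    show "0 < ?F'' x" if "x \<in> {Sb<..<SB}" "x < a" for x using a(1)[of x] that Sb0 by simp
    show "?F'' x < 0" if "x \<in> {Sb<..<SB}" "a < x" for x using a(2)[of x] that SB by simp
    show "Sb \<le> ST" using ST by simp
  qed (fact S)+
qed

section \<open>Travelling waves in the drainage region\<close>

lemma relax_F_above_imbibition:
  assumes "0 < S" "S \<le> 1" and "pc X Imb S \<le> p \<or> pc X Drn S < p"
  shows "relax_F X (S, p) = min 0 (pc X Drn S - p)"
  using assms by (auto simp: relax_F_def reg_drn_def reg_hyst_def)

lemma drainage_pc_derivative:
  assumes X: "hysteretic_flow X" and S: "0 < a" "a < b" "b < 1"
  obtains P' b0 where "\<And>S. S \<in> {a..b} \<Longrightarrow> (pc X Drn has_real_derivative P' S) (at S)"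
    and "continuous_on {a..b} P'" and "0 < b0" and "\<And>S. S \<in> {a..b} \<Longrightarrow> P' S \<le> - b0"
proof -
  define P' where "P' = deriv_within {0<..1} (pc X Drn)"
  have C1: "C1_on {0<..1} (pc X Drn)" and neg: "\<And>S. S \<in> {0<..<1} \<Longrightarrow> P' S < 0"
    using X by (auto simp: hysteretic_flow_def capillary_ok_def P'_def)
  have cP': "continuous_on {a..b} P'"
    using C1 S unfolding C1_on_def P'_def by (auto intro: continuous_on_subset)
  have "{a..b} \<noteq> {}" using S by simp
  then obtain s where s: "s \<in> {a..b}" "\<And>S. S \<in> {a..b} \<Longrightarrow> P' S \<le> P' s"
    using continuous_attains_sup[OF compact_Icc _ cP'] by blast
  show thesis
  proof (rule that[of P' "- P' s"])
    show "(pc X Drn has_real_derivative P' x) (at x)" if "x \<in> {a..b}" for x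
    proof -
      have "{0<..<1::real} \<subseteq> interior {0<..1}" by (rule interior_maximal) auto
      then show ?thesis
        unfolding P'_def
        by (intro has_real_derivative_deriv_within_interior[OF C1]) (use that S in auto)
    qed
  qed (use cP' s neg[of s] S in auto)
qed

theorem proposition4p3:
  fixes X :: hyst_data and SB pB Sb ST pT :: real
  assumes "hysteretic_flow X"
    and "0 < SB" and "SB < 1" and "pB \<in> {pc X Imb SB..pc X Drn SB}"
    and "drainage_tangent_point X SB pB Sb"
    and "ST \<in> {Sb..<SB}" and "0 < ST" and "pT = pc X Drn ST"
    and "flux_br X Drn ST < flux X (SB, pB)"
  shows "\<exists>\<tau>d>0. \<exists>Sd pd :: real \<Rightarrow> real \<Rightarrow> real. \<exists>P :: real \<Rightarrow> real \<Rightarrow> real.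
    (\<forall>\<tau>. 0 < \<tau> \<and> \<tau> < \<tau>d \<longrightarrow>
       TW_orbit X \<tau> (SB, pB) (ST, pT) (Sd \<tau>) (pd \<tau>) \<and>
       connects (Sd \<tau>) (pd \<tau>) (SB, pB) (ST, pT) \<and>
       leaves_through_drainage X SB pB (Sd \<tau>) (pd \<tau>) \<and>
       orbit_pressure (Sd \<tau>) (pd \<tau>) ST SB (P \<tau>)) \<and>
    (\<forall>S\<in>{ST..<SB}. ((\<lambda>\<tau>. P \<tau> S) \<longlongrightarrow> pc X Drn S) (at_right 0))"
proof -
  note X = assms(1) and SB = assms(2,3) and pB = assms(4)
  let ?F = "flux_br X Drn" and ?P = "pc X Drn"
  define FB where "FB = flux X (SB, pB)"
  define c where "c = wave_speed X (SB, pB) (ST, pT)"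
  define G where "G = TW_G X (SB, pB) (ST, pT)"
  define N where "N S = ?F S - (FB + c * (S - SB))" for S
  define H where "H S = grav_h X (S, ?P S)" for S
  define g where "g S = N S / H S" for S
  have ST: "0 < ST" "ST < SB" "ST < 1" using assms SB by auto
  have c_eq: "c = (?F ST - FB) / (ST - SB)"
    using flux_drainage(1)[OF X ST(1,3), of pT] assms(8) by (simp add: c_def wave_speed_def FB_def)
  have c: "0 < c" using assms(9) ST unfolding c_eq FB_def[symmetric] by (intro divide_neg_neg) auto
  have G_eq: "G (S, p) = (flux X (S, p) - (FB + c * (S - SB))) / grav_h X (S, p)" for S p
    by (simp add: G_def TW_G_def chord_def c_def FB_def)
  have G_drn: "G (S, p) = g S" if "S \<in> {ST..SB}" "?P S \<le> p" for S p
    using flux_drainage[OF X, of S] that ST SB by (simp add: G_eq g_def N_def H_def)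
  have H_pos: "0 < H S" if "S \<in> {ST..SB}" for S
    unfolding H_def by (rule grav_h_pos[OF X]) (use that ST SB in auto)
  have N_ST: "N ST = 0" using ST by (simp add: N_def c_eq)
  have N_pos: "0 < N S" if "S \<in> {ST<..<SB}" for S
    using drainage_flux_above_chord[OF X SB pB assms(5,6), of S] that
    by (simp add: N_def c_eq FB_def)
  have N_SB: "N SB = 0" if "pB = ?P SB"
    using flux_drainage(1)[OF X SB, of pB] that by (simp add: N_def FB_def)
  obtain P' b0 where dP: "\<And>S. S \<in> {ST..SB} \<Longrightarrow> (?P has_real_derivative P' S) (at S)"
    and cP': "continuous_on {ST..SB} P'" and b0: "0 < b0"
    and P': "\<And>S. S \<in> {ST..SB} \<Longrightarrow> P' S \<le> - b0"
    using drainage_pc_derivative[OF X ST(1,2) SB(2)] by blast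
  have cP: "continuous_on {ST..SB} ?P"
    by (rule DERIV_continuous_on[OF has_field_derivative_at_within[OF dP]])
  have cH: "continuous_on {ST..SB} H"
    unfolding H_def
  proof (rule continuous_on_compose2[OF continuous_grav_h[OF X subset_refl]])
    show "continuous_on {ST..SB} (\<lambda>S. (S, ?P S))" by (intro continuous_intros cP)
    show "(\<lambda>S. (S, ?P S)) ` {ST..SB} \<subseteq> {0<..<1} \<times> UNIV" using ST SB by auto
  qed
  have C1: "C1_on {0..1} ?F"
    using X by (auto simp: hysteretic_flow_def flux_ok_def C2_on_def)
  define N' where "N' S = deriv_within {0..1} ?F S - c" for S
  have dN: "(N has_real_derivative N' S) (at S)" if "S \<in> {ST..SB}" for S
    unfolding N_def N'_def
    using has_real_derivative_deriv_within_interior[OF C1, of S] that ST SB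
    by (auto intro!: derivative_eq_intros)
  have cN: "continuous_on {ST..SB} N"
    by (rule DERIV_continuous_on[OF has_field_derivative_at_within[OF dN]])
  have "continuous_on {ST..SB} (deriv_within {0..1} ?F)"
    by (rule continuous_on_subset[of "{0..1}"]) (use C1 ST SB in \<open>auto simp: C1_on_def\<close>)
  hence "continuous_on {ST..SB} N'" unfolding N'_def by (intro continuous_intros)
  then obtain B where B: "0 < B" "\<And>S. S \<in> {ST..SB} \<Longrightarrow> \<bar>N' S\<bar> \<le> B"
    by (rule continuous_on_Icc_bounded) blast
  \<comment> \<open>\<open>N\<close> is Lipschitz and vanishes at \<open>S\<^sub>T\<close>, and also at \<open>S\<^sub>B\<close> if \<open>p\<^sub>B\<close> lies on the drainage curve; so \<open>g\<close> is
    at most linear there\<close>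
  have N_lip: "\<bar>N x - N y\<bar> \<le> B * \<bar>x - y\<bar>" if "x \<in> {ST..SB}" "y \<in> {ST..SB}" for x y
  proof -
    have "norm (N x - N y) \<le> B * norm (x - y)"
      by (rule field_differentiable_bound[of "{ST..SB}" N N'])
         (use B(2) that in \<open>auto intro: has_field_derivative_at_within[OF dN]\<close>)
    then show ?thesis by simp
  qed
  have "{ST..SB} \<noteq> {}" using ST by simp
  then obtain s where s: "s \<in> {ST..SB}" "\<And>S. S \<in> {ST..SB} \<Longrightarrow> H s \<le> H S"
    using continuous_attains_inf[OF compact_Icc _ cH] by blast
  define K where "K = B / H s"
  have K: "0 < K" using B H_pos[OF s(1)] by (simp add: K_def)
  have g_bound: "g S \<le> K * d" if "S \<in> {ST..SB}" "N S \<le> B * d" "0 \<le> d" for S d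
  proof -
    have "g S \<le> (B * d) / H S" unfolding g_def
      using that H_pos[OF that(1)] by (intro divide_right_mono) auto
    also have "\<dots> \<le> (B * d) / H s"
      using s(2)[OF that(1)] H_pos[OF s(1)] B that by (intro divide_left_mono) auto
    finally show ?thesis by (simp add: K_def)
  qed
  have g_le: "g S \<le> K * (S - ST)" if "S \<in> {ST..SB}" for S
    using N_lip[OF that, of ST] ST N_ST that by (intro g_bound that) auto
  have g_le': "g S \<le> K * (SB - S)" if "pB = ?P SB" "S \<in> {ST..SB}" for S
    using N_lip[OF that(2), of SB] ST N_SB[OF that(1)] that(2) by (intro g_bound that) auto
  have cg: "continuous_on {ST..SB} g"
    unfolding g_def by (intro continuous_intros cN cH) (use H_pos in force)
  have g_pos: "0 < g S" if "S \<in> {ST<..<SB}" for S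
    using N_pos[OF that] H_pos[of S] that by (simp add: g_def)
  have G_pos: "0 < G (SB, p)" if "pB < p" "p \<le> ?P SB" for p
  proof -
    have "FB < flux X (SB, p)"
      unfolding FB_def by (rule flux_increasing_in_pressure[OF X SB]) (use pB that in auto)
    then show ?thesis using grav_h_pos[OF X SB] by (simp add: G_eq)
  qed
  \<comment> \<open>one constant for the growth at \<open>E\<^sub>B\<close>, along the vertical line and along the drainage branch\<close>
  obtain A where A: "K \<le> A" and G_le: "\<And>p. \<lbrakk>pB < p; p < ?P SB\<rbrakk> \<Longrightarrow> G (SB, p) \<le> A * (p - pB)"
  proof -
    let ?I = "{pc X Imb SB..?P SB}"
    obtain D where D: "\<forall>p\<in>?I. 0 < D p \<and>
        ((\<lambda>p. flux X (SB, p)) has_real_derivative D p) (at p within ?I)" and cD: "continuous_on ?I D"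
      using flux_pressure_derivative[OF X SB] by (elim exE conjE)
    obtain E where E: "0 < E" "\<And>p. p \<in> ?I \<Longrightarrow> \<bar>D p\<bar> \<le> E"
      using continuous_on_Icc_bounded[OF cD] by metis
    have "continuous_on ?I (\<lambda>p. grav_h X (SB, p))"
      by (rule continuous_on_compose2[OF continuous_grav_h[OF X subset_refl]])
         (use SB in \<open>auto intro!: continuous_intros\<close>)
    moreover have "?I \<noteq> {}" using pB by auto
    ultimately obtain r where r: "r \<in> ?I" "\<And>p. p \<in> ?I \<Longrightarrow> grav_h X (SB, r) \<le> grav_h X (SB, p)"
      using continuous_attains_inf[of ?I "\<lambda>p. grav_h X (SB, p)"] by auto
    show thesis
    proof (rule that[of "max K (E / grav_h X (SB, r))"])
      fix p assume p: "pB < p" "p < ?P SB"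
      have pI: "p \<in> ?I" "pB \<in> ?I" using p pB by auto
      have "norm (flux X (SB, p) - flux X (SB, pB)) \<le> E * norm (p - pB)"
        by (rule field_differentiable_bound[of ?I _ D]) (use D E pI in auto)
      hence "flux X (SB, p) - FB \<le> E * (p - pB)" using p by (simp add: FB_def)
      hence "G (SB, p) \<le> E * (p - pB) / grav_h X (SB, p)"
        using grav_h_pos[OF X SB, of p] by (simp add: G_eq divide_right_mono)
      also have "\<dots> \<le> E * (p - pB) / grav_h X (SB, r)"
        using r(2)[OF pI(1)] grav_h_pos[OF X SB, of r] grav_h_pos[OF X SB, of p] E p
        by (intro divide_left_mono) auto
      also have "\<dots> = E / grav_h X (SB, r) * (p - pB)" by simp
      also have "\<dots> \<le> max K (E / grav_h X (SB, r)) * (p - pB)"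
        using p by (intro mult_right_mono) auto
      finally show "G (SB, p) \<le> max K (E / grav_h X (SB, r)) * (p - pB)" .
    qed simp
  qed
  have A0: "0 \<le> A" using A K by linarith
  have g_le_A: "g S \<le> A * (SB - S)" if "pB = ?P SB" "S \<in> {ST..SB}" for S
  proof -
    have "K * (SB - S) \<le> A * (SB - S)" using A that(2) by (intro mult_right_mono) auto
    with g_le'[OF that] show ?thesis by linarith
  qed
  have cG: "continuous_on ({ST<..SB} \<times> {pB<..<?P ST}) G"
    unfolding G_def by (rule continuous_TW_G[OF X]) (use ST SB in auto)
  have G_drn': "G (S, p) = g S" if "S \<in> {ST<..SB}" "?P S < p" for S p
    using G_drn[of S p] that by simp
  \<comment> \<open>the largest \<open>\<tau>\<close> with \<open>4 e K \<le> b\<^sub>0\<^sup>2\<close> for \<open>e = c \<tau>\<close>\<close>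
  define \<tau>d where "\<tau>d = b0\<^sup>2 / (4 * c * K)"
  have \<tau>d: "0 < \<tau>d" using b0 c K by (simp add: \<tau>d_def)
  have orbit: "\<exists>S p Pr. TW_orbit X \<tau> (SB, pB) (ST, pT) S p \<and> connects S p (SB, pB) (ST, pT) \<and>
      leaves_through_drainage X SB pB S p \<and> orbit_pressure S p ST SB Pr \<and>
      (\<forall>s\<in>{ST..<SB}. \<bar>Pr s - ?P s\<bar> \<le> 2 * (c * \<tau>) * K / b0 * (s - ST))"
    if \<tau>: "0 < \<tau>" "\<tau> < \<tau>d" for \<tau>
  proof -
    have e: "0 < c * \<tau>" using c \<tau> by simp
    have small: "4 * (c * \<tau>) * K \<le> b0\<^sup>2"
      using \<tau>(2) c K by (simp add: \<tau>d_def pos_less_divide_eq mult_ac)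
    have pB_le: "pB \<le> ?P SB" using pB by simp
    obtain S p Pr where
      loc: "\<And>t. S t \<in> {ST<..SB} \<and> pB < p t \<and> p t < ?P ST \<and> (p t \<le> ?P SB \<longrightarrow> S t = SB) \<and>
           (?P SB < p t \<longrightarrow> ?P (S t) < p t)"
      and dS: "\<And>t. (S has_real_derivative min 0 (?P (S t) - p t) / (c * \<tau>)) (at t)"
      and dp: "\<And>t. (p has_real_derivative G (S t, p t)) (at t)"
      and S_bot: "(S \<longlongrightarrow> SB) at_bot" and p_bot: "(p \<longlongrightarrow> pB) at_bot"
      and S_top: "(S \<longlongrightarrow> ST) at_top" and p_top: "(p \<longlongrightarrow> ?P ST) at_top"
      and Pr_ST: "Pr ST = ?P ST"
      and Pr: "\<And>s. s \<in> {ST<..<SB} \<Longrightarrow>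
           ?P s < Pr s \<and> (\<exists>t. S t = s) \<and> (\<forall>t. S t = s \<longrightarrow> p t = Pr s)"
      and Pr_lim: "\<And>s. s \<in> {ST..<SB} \<Longrightarrow> \<bar>Pr s - ?P s\<bar> \<le> 2 * (c * \<tau>) * K / b0 * (s - ST)"
      by (rule drainage_connection[OF ST(2) e K b0 small dP cP' P' cg g_pos g_le pB_le cG G_drn' G_pos A0
            G_le g_le_A]) blast+
    have "relax_F X (S t, p t) = min 0 (?P (S t) - p t)" for t
      by (rule relax_F_above_imbibition) (use loc[of t] ST SB pB in auto)
    hence TW: "TW_orbit X \<tau> (SB, pB) (ST, pT) S p"
      unfolding TW_orbit_def mem_reg_all c_def[symmetric] G_def[symmetric]
      using loc dS dp ST SB by (auto intro: less_imp_le less_trans le_less_trans)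
    have conn: "connects S p (SB, pB) (ST, pT)"
      unfolding connects_def assms(8) by (intro conjI tendsto_Pair S_bot p_bot S_top p_top)
    have leaves: "leaves_through_drainage X SB pB S p"
      unfolding leaves_through_drainage_def
    proof
      show "\<exists>\<xi>0. \<forall>\<xi>\<le>\<xi>0. pB < p \<xi> \<and> (pB < ?P SB \<longrightarrow> S \<xi> = SB)"
      proof (cases "pB < ?P SB")
        case True
        then obtain \<xi>0 where "\<forall>\<xi>\<le>\<xi>0. p \<xi> < ?P SB"
          using order_tendstoD(2)[OF p_bot] by (auto simp: eventually_at_bot_linorder)
        then show ?thesis using loc by (intro exI[of _ \<xi>0]) auto
      qed (use loc in auto)
      obtain s where s: "s \<in> {ST<..<SB}" using dense[OF ST(2)] by auto
      then obtain t where "S t = s" "p t = Pr s" using Pr[OF s] by blast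
      then have "(S t, p t) \<in> reg_drn X" using Pr[OF s] s ST SB by (simp add: reg_drn_def)
      then show "\<exists>\<xi>. (S \<xi>, p \<xi>) \<in> reg_drn X" by blast
    qed
    have press: "orbit_pressure S p ST SB Pr"
      unfolding orbit_pressure_def using Pr p_top Pr_ST by auto
    show ?thesis using TW conn leaves press Pr_lim by blast
  qed
  then obtain Sd pd P where orb: "\<And>\<tau>. \<lbrakk>0 < \<tau>; \<tau> < \<tau>d\<rbrakk> \<Longrightarrow>
      TW_orbit X \<tau> (SB, pB) (ST, pT) (Sd \<tau>) (pd \<tau>) \<and>
      connects (Sd \<tau>) (pd \<tau>) (SB, pB) (ST, pT) \<and>
      leaves_through_drainage X SB pB (Sd \<tau>) (pd \<tau>) \<and>
      orbit_pressure (Sd \<tau>) (pd \<tau>) ST SB (P \<tau>) \<and>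
      (\<forall>s\<in>{ST..<SB}. \<bar>P \<tau> s - ?P s\<bar> \<le> 2 * (c * \<tau>) * K / b0 * (s - ST))"
    by metis
  have "((\<lambda>\<tau>. P \<tau> s) \<longlongrightarrow> ?P s) (at_right 0)" if s: "s \<in> {ST..<SB}" for s
  proof -
    have "((\<lambda>\<tau>. P \<tau> s - ?P s) \<longlongrightarrow> 0) (at_right 0)"
    proof (rule Lim_null_comparison)
      show "\<forall>\<^sub>F \<tau> in at_right 0. norm (P \<tau> s - ?P s) \<le> 2 * (c * \<tau>) * K / b0 * (s - ST)"
        using eventually_at_right_real[OF \<tau>d] by eventually_elim (use orb s in auto)
      have "((\<lambda>\<tau>. 2 * (c * \<tau>) * K / b0 * (s - ST)) \<longlongrightarrow> 2 * (c * 0) * K / b0 * (s - ST)) (at_right 0)"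
        using b0 by (intro tendsto_intros) auto
      then show "((\<lambda>\<tau>. 2 * (c * \<tau>) * K / b0 * (s - ST)) \<longlongrightarrow> 0) (at_right 0)" by simp
    qed
    then show ?thesis by (simp add: LIM_zero_iff)
  qed
  with \<tau>d orb show ?thesis by blast
qed

end
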